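(* Let $Z=[z_0:z_1:\ldots:z_n]$ be the homogeneous coordinate system of $\mathbb{CP}^n$, and let $\Lambda=\sum_{\alpha,\beta}\overleftarrow{\partial_{Z_\alpha}}\,\Lambda^{\alpha,\beta}\,\overrightarrow{\partial_{Z_\beta}}$ be a holomorphic skew-symmetric biderivation of order zero acting on the structure sheaf $\mathcal{O}_{\mathbb{CP}^n}$ which satisfies the Jacobi rule and, for every $k\ge 1$, $$\bigl(\overleftarrow{\partial_{Z_{\alpha_1}}}\Lambda^{\alpha_1,\beta_1}\overrightarrow{\partial_{Z_{\beta_1}}}\bigr)\cdots\bigl(\overleftarrow{\partial_{Z_{\alpha_k}}}\Lambda^{\alpha_k,\beta_k}\overrightarrow{\partial_{Z_{\beta_k}}}\bigr)=\overleftarrow{\partial_{Z_{\alpha_1\ldots\alpha_k}}}\,\Lambda^{\alpha_1,\beta_1}\cdots\Lambda^{\alpha_k,\beta_k}\,\overrightarrow{\partial_{Z_{\beta_1\ldots\beta_k}}}.$$ Then the product $$f\star g=\sum_{k=0}^\infty\frac1{k!}\Bigl(\frac{\mu}{2}\Bigr)^k\Lambda^{\alpha_1\beta_1}\cdots\Lambda^{\alpha_k\beta_k}\,\partial_{Z_{\alpha_1}}\cdots\partial_{Z_{\alpha_k}}f\;\partial_{Z_{\beta_1}}\cdots\partial_{Z_{\beta_k}}g$$ induces a globally defined non-commutative, associative product on the sheaf-cohomology space $\sum_{k=0}^\infty H^0(\mathbb{CP}^n,\mathcal{O}_{\mathbb{CP}^n}(k))$ with the parameter $\mu$ adjoined,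 and $\mu$ can be specialized to a scalar (for example $\mu=1$).
   Context: Indices $\alpha,\beta,\alpha_i,\beta_i$ run over $0,\dots,n$, and repeated indices are summed (Einstein convention). Sections of $\mathcal{O}_{\mathbb{CP}^n}(k)$ are regarded as holomorphic functions of $Z=(z_0,\dots,z_n)$, homogeneous of degree $k$, on (cones in) $\mathbb{C}^{n+1}\setminus\{0\}$, so that $H^0(\mathbb{CP}^n,\mathcal{O}(k))$ is the space of homogeneous polynomials of degree $k$; $\partial_{Z_\alpha}=\partial/\partial z_\alpha$. The biderivation is $f\Lambda g=\Lambda^{\alpha,\beta}(Z)\,\partial_{Z_\alpha}f\,\partial_{Z_\beta}g$ with holomorphic coefficients, $\Lambda^{\alpha,\beta}=-\Lambda^{\beta,\alpha}$. "Order zero" means that it preserves homogeneity degree (the coefficients $\Lambda^{\alpha,\beta}$ are homogeneous of degree $2$ in $Z$). The Jacobi rule means that $\{f,g\}=f\Lambda g$ satisfies the Jacobi identity. Arrow notation: $f\,\overleftarrow{\partial_{Z_{\alpha_1\ldots\alpha_k}}}$ means $\partial_{Z_{\alpha_1}}\cdots\partial_{Z_{\alpha_k}}f$, and $\overrightarrow{\partial_{Z_{\beta_1\ldots\beta_k}}}\,g$ means $\partial_{Z_{\beta_1}}\cdots\partial_{Z_{\beta_k}}g$. The displayed assumption on $\Lambda$ is an identity of bidifferential operators, applied between arbitrary homogeneous holomorphic functions $f$ (on the left) and $g$ (on the right); in the product on the left-hand side, each left-pointing arrow differentiates (by the Leibniz rule) everything to its left, and each right-pointing arrow everything to its right, including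 the coefficients $\Lambda^{\alpha_i,\beta_i}$; thus the assumption says that the derivatives of the coefficients give no total contribution. Here $\sum_k$ is the direct sum, "with the parameter $\mu$ adjoined" means coefficients in Laurent polynomials $\mathbb{C}[\mu,\mu^{-1}]$, and $\star$ is extended $\mu$-linearly. "Non-commutative" means not necessarily commutative. *)

theory Defs
  imports "HOL-Analysis.Analysis" "HOL-Library.Function_Algebras" "HOL-Library.Poly_Mapping"
begin

text \<open>
  The homogeneous coordinates \<open>z\<^sub>0, \<dots>, z\<^sub>n\<close> are indexed by a finite type \<open>'n\<close> with
  \<open>n + 1\<close> elements, so \<open>complex ^ 'n\<close> is the space of the vectors \<open>Z\<close>.
\<close>

section \<open>Sections of the sheaves \<open>\<O>(k)\<close> on projective space\<close>

text \<open>Holomorphy in several variables: Frechet differentiability with complex linear derivative.\<close>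

definition holomorphic_vec :: "(complex ^ 'n \<Rightarrow> complex) \<Rightarrow> (complex ^ 'n) set \<Rightarrow> bool" where
  "holomorphic_vec f U \<longleftrightarrow>
     (\<forall>Z\<in>U. \<exists>D. (f has_derivative D) (at Z) \<and> (\<forall>c v. D (c *s v) = c * D v))"

text \<open>Open subsets of projective space, given by the open cones in \<open>\<complex>\<^sup>n\<^sup>+\<^sup>1 - {0}\<close> above them.\<close>

definition open_cone :: "(complex ^ 'n) set \<Rightarrow> bool" where
  "open_cone U \<longleftrightarrow> open U \<and> 0 \<notin> U \<and> (\<forall>Z\<in>U. \<forall>c. c \<noteq> 0 \<longrightarrow> c *s Z \<in> U)"

text \<open>
  A section of \<open>\<O>(k)\<close> over the cone \<open>U\<close> is a function on \<open>U\<close>. It is represented by its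
  extension by \<open>0\<close> to the whole type, so that equality of sections is equality of functions.
  In particular the value of a global section at the origin is \<open>0\<close>, also for \<open>k = 0\<close>.
\<close>

definition sections :: "int \<Rightarrow> (complex ^ 'n) set \<Rightarrow> (complex ^ 'n \<Rightarrow> complex) set" where
  "sections k U = {f. holomorphic_vec f U \<and>
     (\<forall>Z\<in>U. \<forall>c. c \<noteq> 0 \<longrightarrow> f (c *s Z) = c powi k * f Z) \<and>
     (\<forall>Z. Z \<notin> U \<longrightarrow> f Z = 0)}"

definition H0 :: "nat \<Rightarrow> (complex ^ 'n \<Rightarrow> complex) set" where
  "H0 k = sections (int k) (UNIV - {0})"


section \<open>Bidifferential operators\<close>

definition pd :: "'n \<Rightarrow> (complex ^ 'n \<Rightarrow> complex) \<Rightarrow> complex ^ 'n \<Rightarrow> complex" where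
  "pd \<alpha> f Z = deriv (\<lambda>t. f (Z + axis \<alpha> t)) 0"

definition pds :: "'n list \<Rightarrow> (complex ^ 'n \<Rightarrow> complex) \<Rightarrow> complex ^ 'n \<Rightarrow> complex" where
  "pds as f = foldr pd as f"

definition bracket ::
  "('n \<Rightarrow> 'n \<Rightarrow> complex ^ 'n \<Rightarrow> complex) \<Rightarrow> (complex ^ 'n \<Rightarrow> complex) \<Rightarrow> (complex ^ 'n \<Rightarrow> complex)
     \<Rightarrow> complex ^ 'n \<Rightarrow> complex" where
  "bracket \<Lambda> f g Z = (\<Sum>\<alpha>\<in>UNIV. \<Sum>\<beta>\<in>UNIV. \<Lambda> \<alpha> \<beta> Z * pd \<alpha> f Z * pd \<beta> g Z)"

abbreviation multi_indices :: "nat \<Rightarrow> (nat \<Rightarrow> 'n) set" where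
  "multi_indices k \<equiv> PiE {1..k} (\<lambda>_. UNIV)"

text \<open>
  The operator whose coefficients are not differentiated:
  \<open>\<Lambda>\<^sup>\<alpha>\<^sup>1\<^sup>\<beta>\<^sup>1 \<cdots> \<Lambda>\<^sup>\<alpha>\<^sup>k\<^sup>\<beta>\<^sup>k \<partial>\<^sub>\<alpha>\<^sub>1 \<cdots> \<partial>\<^sub>\<alpha>\<^sub>k f \<partial>\<^sub>\<beta>\<^sub>1 \<cdots> \<partial>\<^sub>\<beta>\<^sub>k g\<close>, summed over all indices.
\<close>

definition normal_product ::
  "('n \<Rightarrow> 'n \<Rightarrow> complex ^ 'n \<Rightarrow> complex) \<Rightarrow> nat \<Rightarrow> (complex ^ 'n \<Rightarrow> complex)
     \<Rightarrow> (complex ^ 'n \<Rightarrow> complex) \<Rightarrow> complex ^ 'n \<Rightarrow> complex" where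
  "normal_product \<Lambda> k f g Z =
     (\<Sum>a\<in>multi_indices k. \<Sum>b\<in>multi_indices k.
        (\<Prod>i\<in>{1..k}. \<Lambda> (a i) (b i) Z)
          * pds (map a [1..<k+1]) f Z * pds (map b [1..<k+1]) g Z)"

text \<open>
  The product \<open>f (\<partial>\<^sub>\<alpha>\<^sub>1 \<Lambda>\<^sup>\<alpha>\<^sup>1\<^sup>\<beta>\<^sup>1 \<partial>\<^sub>\<beta>\<^sub>1) \<cdots> (\<partial>\<^sub>\<alpha>\<^sub>k \<Lambda>\<^sup>\<alpha>\<^sup>k\<^sup>\<beta>\<^sup>k \<partial>\<^sub>\<beta>\<^sub>k) g\<close>, where the first derivative in each
  bracket acts on everything to its left and the second one on everything to its right. It
  contains \<open>k + 2\<close> functions: \<open>f\<close> at position \<open>0\<close>, the coefficient of the \<open>i\<close>-th bracket at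
  position \<open>i\<close>, and \<open>g\<close> at position \<open>k + 1\<close>. By the Leibniz rule the left derivative of
  bracket \<open>i\<close> falls on exactly one position \<open>l i < i\<close> and the right one on exactly one
  position \<open>r i > i\<close>; the result is the sum over all these choices.
\<close>

definition arrow_product ::
  "('n \<Rightarrow> 'n \<Rightarrow> complex ^ 'n \<Rightarrow> complex) \<Rightarrow> nat \<Rightarrow> (complex ^ 'n \<Rightarrow> complex)
     \<Rightarrow> (complex ^ 'n \<Rightarrow> complex) \<Rightarrow> complex ^ 'n \<Rightarrow> complex" where
  "arrow_product \<Lambda> k f g Z =
     (\<Sum>a\<in>multi_indices k. \<Sum>b\<in>multi_indices k.
      \<Sum>l\<in>PiE {1..k} (\<lambda>i. {0..<i}). \<Sum>r\<in>PiE {1..k} (\<lambda>i. {i<..k+1}).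
        \<Prod>j\<in>{0..k+1}.
          pds (map a (filter (\<lambda>i. l i = j) [1..<k+1]) @ map b (filter (\<lambda>i. r i = j) [1..<k+1]))
            (if j = 0 then f else if j = k + 1 then g else \<Lambda> (a j) (b j)) Z)"


section \<open>The star product\<close>

text \<open>
  The coefficient of \<open>\<mu>\<^sup>k\<close> in \<open>f \<star> g\<close> for global sections \<open>f\<close>, \<open>g\<close>; the case distinction is the
  convention on the values at the origin made in \<^const>\<open>sections\<close>.
\<close>

definition star_coeff ::
  "('n \<Rightarrow> 'n \<Rightarrow> complex ^ 'n \<Rightarrow> complex) \<Rightarrow> nat \<Rightarrow> (complex ^ 'n \<Rightarrow> complex)
     \<Rightarrow> (complex ^ 'n \<Rightarrow> complex) \<Rightarrow> complex ^ 'n \<Rightarrow> complex" where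
  "star_coeff \<Lambda> k f g Z =
     (if Z = 0 then 0 else 1 / fact k * (1 / 2) ^ k * normal_product \<Lambda> k f g Z)"

text \<open>
  The external direct sum of all \<^term>\<open>H0 p\<close>: \<open>F p\<close> is the component in degree \<open>p\<close>.
  With \<open>\<mu>\<close> adjoined, \<open>F p i\<close> is the coefficient of \<open>\<mu>\<^sup>i\<close> in the component of degree \<open>p\<close>.
  The ring of Laurent polynomials in \<open>\<mu>\<close> is the type \<^typ>\<open>int \<Rightarrow>\<^sub>0 complex\<close>.
\<close>

definition H0_sum :: "(nat \<Rightarrow> complex ^ 'n \<Rightarrow> complex) set" where
  "H0_sum = {F. (\<forall>p. F p \<in> H0 p) \<and> finite {p. F p \<noteq> 0}}"

definition H0_sum_mu :: "(nat \<Rightarrow> int \<Rightarrow> complex ^ 'n \<Rightarrow> complex) set" where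
  "H0_sum_mu = {F. (\<forall>p i. F p i \<in> H0 p) \<and> finite {(p, i). F p i \<noteq> 0}}"

definition scale_C :: "complex \<Rightarrow> (nat \<Rightarrow> complex ^ 'n \<Rightarrow> complex) \<Rightarrow> nat \<Rightarrow> complex ^ 'n \<Rightarrow> complex"
  where "scale_C c F = (\<lambda>p Z. c * F p Z)"

definition scale_mu ::
  "(int \<Rightarrow>\<^sub>0 complex) \<Rightarrow> (nat \<Rightarrow> int \<Rightarrow> complex ^ 'n \<Rightarrow> complex)
     \<Rightarrow> nat \<Rightarrow> int \<Rightarrow> complex ^ 'n \<Rightarrow> complex" where
  "scale_mu r F = (\<lambda>p i Z. \<Sum>s\<in>Poly_Mapping.keys r. Poly_Mapping.lookup r s * F p (i - s) Z)"

text \<open>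
  The \<open>\<mu>\<close>-linear extension of the star product: the component of degree \<open>m\<close> and \<open>\<mu>\<close>-exponent
  \<open>j\<close> collects the products of \<open>F p s \<mu>\<^sup>s\<close> and \<open>G (m - p) t \<mu>\<^sup>t\<close> taken in order \<open>k = j - s - t\<close>.
  All orders \<open>k\<close> occur; that only finitely many of them contribute is not built in.
\<close>

definition star_mu ::
  "('n \<Rightarrow> 'n \<Rightarrow> complex ^ 'n \<Rightarrow> complex) \<Rightarrow> (nat \<Rightarrow> int \<Rightarrow> complex ^ 'n \<Rightarrow> complex)
     \<Rightarrow> (nat \<Rightarrow> int \<Rightarrow> complex ^ 'n \<Rightarrow> complex) \<Rightarrow> nat \<Rightarrow> int \<Rightarrow> complex ^ 'n \<Rightarrow> complex" where
  "star_mu \<Lambda> F G = (\<lambda>m j Z.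
     \<Sum>p\<le>m. \<Sum>s\<in>{s. F p s \<noteq> 0}. \<Sum>t\<in>{t. G (m - p) t \<noteq> 0}.
       if s + t \<le> j then star_coeff \<Lambda> (nat (j - s - t)) (F p s) (G (m - p) t) Z else 0)"

text \<open>The star product with \<open>\<mu>\<close> replaced by a scalar \<open>c\<close>.\<close>

definition star_at ::
  "complex \<Rightarrow> ('n \<Rightarrow> 'n \<Rightarrow> complex ^ 'n \<Rightarrow> complex) \<Rightarrow> (nat \<Rightarrow> complex ^ 'n \<Rightarrow> complex)
     \<Rightarrow> (nat \<Rightarrow> complex ^ 'n \<Rightarrow> complex) \<Rightarrow> nat \<Rightarrow> complex ^ 'n \<Rightarrow> complex" where
  "star_at c \<Lambda> F G = (\<lambda>m Z. \<Sum>p\<le>m. suminf (\<lambda>k. c ^ k * star_coeff \<Lambda> k (F p) (G (m - p)) Z))"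

definition specialize ::
  "complex \<Rightarrow> (nat \<Rightarrow> int \<Rightarrow> complex ^ 'n \<Rightarrow> complex) \<Rightarrow> nat \<Rightarrow> complex ^ 'n \<Rightarrow> complex" where
  "specialize c F = (\<lambda>p Z. \<Sum>i\<in>{i. F p i \<noteq> 0}. c powi i * F p i Z)"

definition assoc_bilinear_product ::
  "'v set \<Rightarrow> ('s \<Rightarrow> 'v \<Rightarrow> 'v) \<Rightarrow> ('v :: plus \<Rightarrow> 'v \<Rightarrow> 'v) \<Rightarrow> bool" where
  "assoc_bilinear_product V smul prd \<longleftrightarrow>
     (\<forall>x\<in>V. \<forall>y\<in>V. prd x y \<in> V) \<and>
     (\<forall>x\<in>V. \<forall>y\<in>V. \<forall>z\<in>V. prd (x + y) z = prd x z + prd y z) \<and>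
     (\<forall>x\<in>V. \<forall>y\<in>V. \<forall>z\<in>V. prd x (y + z) = prd x y + prd x z) \<and>
     (\<forall>c. \<forall>x\<in>V. \<forall>y\<in>V. prd (smul c x) y = smul c (prd x y) \<and> prd x (smul c y) = smul c (prd x y)) \<and>
     (\<forall>x\<in>V. \<forall>y\<in>V. \<forall>z\<in>V. prd (prd x y) z = prd x (prd y z))"

end

theory Submission
  imports Defs "HOL-Complex_Analysis.Cauchy_Integral_Formula"
begin

text \<open>
  The point is that the hypotheses force the coefficients of \<open>\<Lambda>\<close> to be Casimirs: the Hamiltonian vector
  field \<open>\<Lambda>\<^sup>d\<^sup>c \<partial>\<^sub>d\<close> of every coordinate annihilates every \<open>\<Lambda>\<^sup>a\<^sup>b\<close>. The arrow condition for \<open>k = 2\<close>, tested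
  on linear and quadratic polynomials, says that this derivative of \<open>\<Lambda>\<^sup>a\<^sup>b\<close> changes sign under
  exchanging \<open>b\<close> and \<open>c\<close>. With skew symmetry it is then antisymmetric in all three indices, and the Jacobi
  identity on coordinates says that three times it is zero
  (\<open>casimir_if_arrow_2_and_jacobi\<close>).

  For Casimir coefficients the star product is associative for the same reason as the Moyal product
  with constant coefficients. Wherever a derivative in one factor of a triple product meets a
  coefficient coming from the other product, it is contracted with \<open>\<Lambda>\<close>, so it is a Hamiltonian vector
  field and passes through the coefficient (\<open>N_casimir_left\<close>, \<open>ham_N\<close>). Hence both \<open>(f \<star> g) \<star> h\<close> and
  \<open>f \<star> (g \<star> h)\<close> are the exponential of \<open>\<Lambda>\<^sub>1\<^sub>2 + \<Lambda>\<^sub>1\<^sub>3 + \<Lambda>\<^sub>2\<^sub>3\<close> applied to \<open>f \<otimes> g \<otimes> h\<close>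
  (\<open>sum_N_N_left\<close>, \<open>sum_N_N_right\<close>).

  All this takes place among polynomials, because the global sections of \<open>\<O>(p)\<close> are the homogeneous
  polynomials of degree \<open>p\<close> (\<open>H0_eq_cut\<close>): along coordinate lines they grow like polynomials of degree
  \<open>p\<close>, so by Liouville's theorem they are polynomials in each coordinate, and interpolation
  in one coordinate after the other makes them polynomials in all. In particular \<open>k\<close> derivatives kill a
  section of degree below \<open>k\<close>, so each star product is a finite sum.

  For a scalar value \<open>c\<close> of the parameter, the direct sum over all degrees inherits associativity from its
  homogeneous components (\<open>star_at_assoc\<close>). For Laurent polynomials in the parameter, specialization to
  all nonzero scalars is compatible with the products and jointly injective (\<open>specialize_star_mu\<close>,
  \<open>specialize_inject\<close>), so the identities follow from those at scalars.
\<close>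

section \<open>Polynomial functions and their partial derivatives\<close>

lemma sum_fun_apply: "(\<Sum>i\<in>A. f i) x = (\<Sum>i\<in>A. f i x)"
  by (induction A rule: infinite_finite_induct) auto

text \<open>
  Polynomials in the coordinates are represented as functions, generated from constants and
  coordinates. Induction over this generation gives existence, closure and commutation of their
  partial derivatives.
\<close>

inductive_set polyfun :: "(complex ^ 'n \<Rightarrow> complex) set" where
  const: "(\<lambda>_. c) \<in> polyfun"
| coord: "(\<lambda>Z. Z $ i) \<in> polyfun"
| add: "f \<in> polyfun \<Longrightarrow> g \<in> polyfun \<Longrightarrow> (\<lambda>Z. f Z + g Z) \<in> polyfun"
| mult: "f \<in> polyfun \<Longrightarrow> g \<in> polyfun \<Longrightarrow> (\<lambda>Z. f Z * g Z) \<in> polyfun"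

lemma polyfun_add: "f \<in> polyfun \<Longrightarrow> g \<in> polyfun \<Longrightarrow> f + g \<in> polyfun"
  unfolding plus_fun_def by (rule polyfun.add)

lemma polyfun_mult: "f \<in> polyfun \<Longrightarrow> g \<in> polyfun \<Longrightarrow> f * g \<in> polyfun"
  unfolding times_fun_def by (rule polyfun.mult)

lemma polyfun_zero: "0 \<in> polyfun"
  using polyfun.const[of 0] by (simp add: zero_fun_def)

lemma polyfun_one: "1 \<in> polyfun"
  using polyfun.const[of 1] by (simp add: one_fun_def)

lemma polyfun_sum: "(\<And>i. i \<in> A \<Longrightarrow> f i \<in> polyfun) \<Longrightarrow> sum f A \<in> polyfun"
  by (induction A rule: infinite_finite_induct) (auto intro: polyfun_zero polyfun_add)

lemmas polyfun_intros =
  polyfun.const polyfun.coord polyfun_add polyfun_mult polyfun_zero polyfun_one polyfun_sum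

lemma polyfun_complex_differentiable:
  assumes "f \<in> polyfun"
  shows "\<exists>D. (f has_derivative D) (at Z) \<and> (\<forall>c v. D (c *s v) = c * D v)"
  using assms
proof induction
  case (const c)
  show ?case by (rule exI[of _ "\<lambda>_. 0"]) auto
next
  case (coord i)
  have "((\<lambda>Z. Z $ i) has_derivative (\<lambda>v. v $ i)) (at Z)"
    by (intro bounded_linear_imp_has_derivative bounded_linear_vec_nth)
  then show ?case by (intro exI[of _ "\<lambda>v. v $ i"]) auto
next
  case (add f g)
  then obtain D E where "(f has_derivative D) (at Z)" "\<forall>c v. D (c *s v) = c * D v"
    "(g has_derivative E) (at Z)" "\<forall>c v. E (c *s v) = c * E v" by blast
  then show ?case
    by (intro exI[of _ "\<lambda>v. D v + E v"]) (auto intro: has_derivative_add simp: algebra_simps)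
next
  case (mult f g)
  then obtain D E where "(f has_derivative D) (at Z)" "\<forall>c v. D (c *s v) = c * D v"
    "(g has_derivative E) (at Z)" "\<forall>c v. E (c *s v) = c * E v" by blast
  then show ?case
    using has_derivative_mult[of f D Z UNIV g E]
    by (intro exI[of _ "\<lambda>v. f Z * E v + D v * g Z"]) (auto simp: algebra_simps)
qed

lemma polyfun_continuous: "f \<in> polyfun \<Longrightarrow> continuous (at Z) f"
  using polyfun_complex_differentiable has_derivative_continuous by blast

lemma polyfun_holomorphic_vec: "f \<in> polyfun \<Longrightarrow> holomorphic_vec f U"
  unfolding holomorphic_vec_def using polyfun_complex_differentiable by blast

lemma bounded_linear_axis: "bounded_linear (axis i :: complex \<Rightarrow> complex ^ 'n::finite)"
proof -
  have "linear (axis i :: complex \<Rightarrow> complex ^ 'n)"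
    by (rule linearI) (auto simp: axis_def vec_eq_iff)
  then show ?thesis by (simp add: linear_conv_bounded_linear)
qed

lemma holomorphic_vec_line:
  assumes "holomorphic_vec f U" "Z + axis i t \<in> U"
  shows "(\<lambda>t. f (Z + axis i t)) field_differentiable (at t)"
proof -
  obtain D where D: "(f has_derivative D) (at (Z + axis i t))" "\<And>c v. D (c *s v) = c * D v"
    using assms unfolding holomorphic_vec_def by blast
  have "((\<lambda>t. Z + axis i t) has_derivative (axis i)) (at t)"
    by (auto intro!: derivative_eq_intros bounded_linear_imp_has_derivative bounded_linear_axis)
  then have "((\<lambda>t. f (Z + axis i t)) has_derivative (\<lambda>s. D (axis i s))) (at t)"
    by (rule has_derivative_compose[where g = f]) (rule D(1))
  moreover have "(\<lambda>s. D (axis i s)) = (*) (D (axis i 1))"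
  proof
    fix s :: complex
    have "axis i s = s *s (axis i 1 :: complex ^ 'a)" by (auto simp: axis_def vec_eq_iff)
    then show "D (axis i s) = D (axis i 1) * s" using D(2)[of s "axis i 1"] by (simp add: mult.commute)
  qed
  ultimately show ?thesis
    unfolding field_differentiable_def has_field_derivative_def by auto
qed

lemma polyfun_has_pd:
  assumes "f \<in> polyfun"
  shows "((\<lambda>t. f (Z + axis i t)) has_field_derivative pd i f Z) (at 0)"
  using holomorphic_vec_line[OF polyfun_holomorphic_vec[OF assms, of UNIV], of Z i 0]
  unfolding pd_def by (simp add: DERIV_deriv_iff_field_differentiable)

lemma pd_unique:
  "((\<lambda>t. f (Z + axis i t)) has_field_derivative d) (at 0) \<Longrightarrow> pd i f Z = d"
  unfolding pd_def by (rule DERIV_imp_deriv)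

lemma pd_const [simp]: "pd i (\<lambda>_. c) = 0"
  by (rule ext, rule pd_unique) auto

lemma pd_coord: "pd i (\<lambda>Z. Z $ j) = (\<lambda>_. if i = j then 1 else 0)"
  by (rule ext, rule pd_unique) (auto simp: axis_def intro!: derivative_eq_intros)

lemma axis_zero_eq [simp]: "axis i 0 = 0"
  by (auto simp: axis_def vec_eq_iff)

lemma pd_add: "f \<in> polyfun \<Longrightarrow> g \<in> polyfun \<Longrightarrow> pd i (f + g) = pd i f + pd i g"
  by (rule ext, rule pd_unique)
     (simp add: DERIV_add[OF polyfun_has_pd[of f] polyfun_has_pd[of g]])

lemma pd_mult: "f \<in> polyfun \<Longrightarrow> g \<in> polyfun \<Longrightarrow> pd i (f * g) = pd i f * g + f * pd i g"
  by (rule ext, rule pd_unique)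
     (use DERIV_mult[OF polyfun_has_pd[of f] polyfun_has_pd[of g]] in \<open>simp add: axis_zero_eq algebra_simps\<close>)

lemma pd_zero [simp]: "pd i 0 = 0"
  using pd_const[of i 0] by (simp add: zero_fun_def)

lemma pd_sum: "(\<And>j. j \<in> A \<Longrightarrow> f j \<in> polyfun) \<Longrightarrow> pd i (sum f A) = (\<Sum>j\<in>A. pd i (f j))"
  by (induction A rule: infinite_finite_induct) (auto simp: pd_add polyfun_sum)

lemma polyfun_pd: "f \<in> polyfun \<Longrightarrow> pd i f \<in> polyfun"
proof (induction rule: polyfun.induct)
  case (add f g)
  then show ?case using pd_add[of f g i] by (simp add: plus_fun_def polyfun.add)
next
  case (mult f g)
  then have "pd i f * g + f * pd i g \<in> polyfun" by (intro polyfun_intros)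
  then show ?case using mult pd_mult[of f g i] by (simp add: times_fun_def plus_fun_def)
qed (auto simp: pd_coord intro!: polyfun_intros)

lemma pd_commute: "f \<in> polyfun \<Longrightarrow> pd i (pd j f) = pd j (pd i f)"
proof (induction rule: polyfun.induct)
  case (add f g)
  then have "pd i (pd j (f + g)) = pd j (pd i (f + g))"
    by (simp add: pd_add polyfun_pd del: plus_fun_def)
  then show ?case by (simp add: plus_fun_def)
next
  case (mult f g)
  then have "pd i (pd j (f * g)) = pd j (pd i (f * g))"
    by (simp add: pd_add pd_mult polyfun_pd polyfun_intros add_ac)
  then show ?case by (simp add: times_fun_def)
qed (simp_all add: pd_coord)

text \<open>
  A partial derivative at \<open>Z\<close> depends only on the germ at \<open>Z\<close>. This is how computations with
  polynomials on the whole space transfer to sections, which are set to \<open>0\<close> at the origin.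
\<close>

lemma pd_local:
  assumes "\<And>Z. Z \<noteq> 0 \<Longrightarrow> f Z = g Z" and "Z \<noteq> 0"
  shows "pd i f Z = pd i g Z"
  unfolding pd_def
proof (rule deriv_cong_ev)
  have "continuous (at 0) (\<lambda>t. Z + axis i t)"
    by (intro continuous_intros linear_continuous_at bounded_linear_axis)
  then have "((\<lambda>t. Z + axis i t) \<longlongrightarrow> Z) (nhds 0)"
    using tendsto_at_iff_tendsto_nhds[of "\<lambda>t. Z + axis i t" 0] by (simp add: isCont_def)
  then have "\<forall>\<^sub>F t in nhds 0. Z + axis i t \<noteq> 0"
    using assms(2) by (rule tendsto_imp_eventually_ne)
  then show "\<forall>\<^sub>F t in nhds 0. f (Z + axis i t) = g (Z + axis i t)"
    by eventually_elim (use assms(1) in auto)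
qed simp

text \<open>
  The origin is a limit of nonzero points and polynomials are continuous.
\<close>

lemma polyfun_eqI:
  assumes "f \<in> polyfun" "g \<in> polyfun" "\<And>Z. Z \<noteq> 0 \<Longrightarrow> f Z = g Z"
  shows "f = g"
proof
  fix Z
  show "f Z = g Z"
  proof (cases "Z = 0")
    case True
    have f: "f \<midarrow>0\<rightarrow> f 0" and g: "g \<midarrow>0\<rightarrow> g 0"
      using assms polyfun_continuous unfolding isCont_def by blast+
    have "g \<midarrow>0\<rightarrow> f 0"
      by (rule tendsto_cong[THEN iffD1, OF _ f]) (use assms(3) in \<open>auto simp: eventually_at_filter\<close>)
    with g show ?thesis using True LIM_unique by blast
  qed (use assms in auto)
qed

definition homogeneous :: "int \<Rightarrow> (complex ^ 'n \<Rightarrow> complex) \<Rightarrow> bool" where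
  "homogeneous d f \<longleftrightarrow> (\<forall>Z c. c \<noteq> 0 \<longrightarrow> f (c *s Z) = c powi d * f Z)"

lemma polyfun_scale: "f \<in> polyfun \<Longrightarrow> (\<lambda>Z. f (c *s Z)) \<in> polyfun"
proof (induction rule: polyfun.induct)
  case (coord i)
  show ?case using polyfun.mult[OF polyfun.const polyfun.coord, of c i] by simp
qed (auto intro: polyfun.intros)

lemma pd_scale:
  assumes "f \<in> polyfun"
  shows "pd i (\<lambda>Z. f (c *s Z)) Z = c * pd i f (c *s Z)"
proof (rule pd_unique)
  have "((\<lambda>t. c * t) has_field_derivative c) (at 0)" by (auto intro!: derivative_eq_intros)
  moreover have "((\<lambda>t. f (c *s Z + axis i t)) has_field_derivative pd i f (c *s Z)) (at (c * 0))"
    using polyfun_has_pd[OF assms] by simp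
  ultimately have "((\<lambda>t. f (c *s Z + axis i (c * t))) has_field_derivative pd i f (c *s Z) * c) (at 0)"
    by (rule DERIV_chain2[rotated])
  moreover have "c *s Z + axis i (c * t) = c *s (Z + axis i t)" for t
    by (auto simp: vec_eq_iff axis_def algebra_simps)
  ultimately show "((\<lambda>t. f (c *s (Z + axis i t))) has_field_derivative c * pd i f (c *s Z)) (at 0)"
    by (simp add: mult.commute)
qed

lemma homogeneous_pd:
  assumes "f \<in> polyfun" "homogeneous d f"
  shows "homogeneous (d - 1) (pd i f)"
  unfolding homogeneous_def
proof (intro allI impI)
  fix Z c assume c: "c \<noteq> (0 :: complex)"
  have "(\<lambda>Z. f (c *s Z)) = (\<lambda>Z. c powi d) * f"
    using assms(2) c by (auto simp: homogeneous_def)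
  then have "pd i (\<lambda>Z. f (c *s Z)) Z = c powi d * pd i f Z"
    using assms(1) by (simp add: pd_mult polyfun_intros)
  then have "c * pd i f (c *s Z) = c powi d * pd i f Z"
    using pd_scale[OF assms(1)] by metis
  then show "pd i f (c *s Z) = c powi (d - 1) * pd i f Z"
    using c by (simp add: power_int_diff field_simps)
qed

text \<open>
  By homogeneity \<open>c\<^sup>n f(cZ) = f(Z)\<close> with \<open>n = -d > 0\<close>; as \<open>c\<close> tends to \<open>0\<close>, the left-hand side
  tends to \<open>0\<close>. This is what stops the star product: \<open>k\<close> derivatives of a polynomial of degree
  below \<open>k\<close> give \<open>0\<close>.
\<close>

lemma homogeneous_neg_zero:
  assumes "f \<in> polyfun" "homogeneous d f" "d < 0"
  shows "f = 0"
proof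
  fix Z
  show "f Z = 0 Z"
  proof -
    obtain n where n: "- d = int n" "n > 0" using assms(3) by (metis neg_0_less_iff_less pos_int_cases)
    have ev: "c ^ n * f (c *s Z) = f Z" if "c \<noteq> 0" for c
    proof -
      have "f (c *s Z) = c powi (- int n) * f Z"
        using assms(2) that n(1) unfolding homogeneous_def by (metis minus_equation_iff)
      then show ?thesis using that by (simp add: power_int_minus)
    qed
    have "isCont (\<lambda>c. f (c *s Z)) 0"
      using assms(1) by (induction rule: polyfun.induct) (auto intro!: continuous_intros)
    then have "((\<lambda>c. c ^ n * f (c *s Z)) \<longlongrightarrow> 0 ^ n * f (0 *s Z)) (at 0)"
      by (intro tendsto_intros) (simp add: isCont_def)
    moreover have "((\<lambda>c. c ^ n * f (c *s Z)) \<longlongrightarrow> f Z) (at 0)"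
      by (rule tendsto_eventually) (use ev in \<open>auto simp: eventually_at_filter\<close>)
    ultimately have "0 ^ n * f (0 *s Z) = f Z" by (rule LIM_unique)
    then show ?thesis using n(2) by (simp add: zero_power)
  qed
qed


section \<open>Global sections are homogeneous polynomials\<close>

text \<open>
  The section that a polynomial defines, with the convention of value \<open>0\<close> at the origin.
\<close>

definition cut :: "(complex ^ 'n \<Rightarrow> complex) \<Rightarrow> complex ^ 'n \<Rightarrow> complex" where
  "cut f Z = (if Z = 0 then 0 else f Z)"

text \<open>
  The nodes are \<open>1, \<dots>, p + 1\<close> and not \<open>0, \<dots>, p\<close>: a vector one of whose coordinates has been
  replaced by a node is then never the origin, where a section carries no information.
\<close>

lemma lagrange_interpolation:
  "\<exists>l :: nat \<Rightarrow> complex poly. \<forall>q. degree q \<le> p \<longrightarrow>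
     (\<forall>t. poly q t = (\<Sum>j\<in>{1..p+1}. poly (l j) t * poly q (of_nat j)))"
proof -
  define l where "l j = smult (1 / (\<Prod>m\<in>{1..p+1}-{j}. of_nat j - of_nat m))
      (\<Prod>m\<in>{1..p+1}-{j}. [:- of_nat m, 1 :: complex:])" for j :: nat
  have deg: "degree (l j) \<le> p" if "j \<in> {1..p+1}" for j
  proof -
    have "degree (\<Prod>m\<in>{1..p+1}-{j}. [:- of_nat m, 1 :: complex:]) \<le> (\<Sum>m\<in>{1..p+1}-{j}. 1)"
      by (rule order_trans[OF degree_prod_sum_le]) (auto intro!: sum_mono)
    also have "\<dots> = p" using that by simp
    finally show ?thesis unfolding l_def by (rule order_trans[OF degree_smult_le])
  qed
  have node: "poly (l j) (of_nat i) = (if i = j then 1 else 0)"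
    if "i \<in> {1..p+1}" "j \<in> {1..p+1}" for i j
    using that unfolding l_def by (auto simp: poly_prod prod_zero_iff)
  have "poly q t = (\<Sum>j\<in>{1..p+1}. poly (l j) t * poly q (of_nat j))" if q: "degree q \<le> p" for q t
  proof -
    let ?r = "\<Sum>j\<in>{1..p+1}. smult (poly q (of_nat j)) (l j)"
    have "q = ?r"
    proof (rule poly_eqI_degree[where A = "of_nat ` {1..p+1}"])
      fix x :: complex assume "x \<in> of_nat ` {1..p+1}"
      then obtain i where i: "i \<in> {1..p+1}" "x = of_nat i" by blast
      have "poly ?r x = (\<Sum>j\<in>{1..p+1}. poly q (of_nat j) * (if i = j then 1 else 0))"
        unfolding poly_sum by (rule sum.cong) (use i node in auto)
      also have "\<dots> = poly q x" using i by (simp add: if_distrib cong: if_cong)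
      finally show "poly q x = poly ?r x" ..
    next
      have card: "card (of_nat ` {1..p+1} :: complex set) = p + 1"
        by (subst card_image) (auto simp: inj_on_def)
      show "degree q < card (of_nat ` {1..p+1} :: complex set)" using card q by simp
      have "degree ?r \<le> p"
        by (rule degree_sum_le) (auto intro!: order_trans[OF degree_smult_le] deg)
      then show "degree ?r < card (of_nat ` {1..p+1} :: complex set)" using card by simp
    qed
    then show ?thesis by (metis (no_types, lifting) poly_smult poly_sum mult.commute sum.cong)
  qed
  then show ?thesis by blast
qed

lemma polyfun_poly: "(\<lambda>Z. poly q (Z $ i)) \<in> polyfun"
proof (induction q)
  case (pCons a q)
  then show ?case
    using polyfun.add[OF polyfun.const polyfun.mult[OF polyfun.coord pCons.IH], of a i] by simp
qed (simp add: polyfun.const)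

definition set_coord :: "complex ^ 'n \<Rightarrow> 'n \<Rightarrow> complex \<Rightarrow> complex ^ 'n" where
  "set_coord Z i t = (\<chi> k. if k = i then t else Z $ k)"

lemma set_coord_nth: "set_coord Z i t $ k = (if k = i then t else Z $ k)"
  by (simp add: set_coord_def)

lemma set_coord_same: "set_coord Z i (Z $ i) = Z"
  by (simp add: vec_eq_iff set_coord_nth)

lemma set_coord_line: "set_coord Z i t = set_coord Z i 0 + axis i t"
  by (simp add: vec_eq_iff set_coord_nth axis_def)

lemma polyfun_set_coord: "f \<in> polyfun \<Longrightarrow> (\<lambda>Z. f (set_coord Z i t)) \<in> polyfun"
proof (induction rule: polyfun.induct)
  case (coord k)
  then show ?case by (cases "k = i") (auto simp: set_coord_nth intro: polyfun.intros)
qed (auto intro: polyfun.intros)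

lemma of_real_vec_scale: "complex_of_real r *s v = r *\<^sub>R (v :: complex ^ 'n)"
  unfolding vec_eq_iff vector_scaleR_component by (simp add: scaleR_conv_of_real)

lemma H0_D:
  assumes "f \<in> H0 p"
  shows "holomorphic_vec f (UNIV - {0})"
    and "\<And>Z c. Z \<noteq> 0 \<Longrightarrow> c \<noteq> 0 \<Longrightarrow> f (c *s Z) = c ^ p * f Z"
    and "f 0 = 0"
  using assms unfolding H0_def sections_def by auto

text \<open>
  On the unit sphere, \<open>f\<close> is bounded by compactness; homogeneity does the rest.
\<close>

lemma H0_growth:
  fixes f :: "complex ^ 'n \<Rightarrow> complex"
  assumes "f \<in> H0 p"
  shows "\<exists>C\<ge>0. \<forall>Z. Z \<noteq> 0 \<longrightarrow> norm (f Z) \<le> C * norm Z ^ p"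
proof -
  have "continuous_on (sphere 0 1) f"
  proof (rule continuous_at_imp_continuous_on, rule ballI)
    fix Z :: "complex ^ 'n" assume "Z \<in> sphere 0 1"
    then have "Z \<in> UNIV - {0}" by auto
    then show "isCont f Z"
      using H0_D(1)[OF assms] has_derivative_continuous unfolding holomorphic_vec_def by blast
  qed
  then have "bounded (f ` sphere 0 1)"
    by (intro compact_imp_bounded compact_continuous_image) auto
  then obtain C where C: "C > 0" "\<And>Z. Z \<in> sphere 0 1 \<Longrightarrow> norm (f Z) \<le> C"
    unfolding bounded_pos by blast
  have "norm (f Z) \<le> C * norm Z ^ p" if Z: "Z \<noteq> 0" for Z
  proof -
    let ?W = "(1 / norm Z) *\<^sub>R Z"
    have "f Z = f (complex_of_real (norm Z) *s ?W)" using Z by (simp add: of_real_vec_scale)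
    also have "\<dots> = complex_of_real (norm Z) ^ p * f ?W"
      by (rule H0_D(2)[OF assms]) (use Z in auto)
    finally have "norm (f Z) = norm Z ^ p * norm (f ?W)"
      by (simp add: norm_mult norm_power)
    moreover have "norm (f ?W) \<le> C" using Z by (intro C) auto
    ultimately show ?thesis
      by (metis mult.commute mult_left_mono norm_ge_zero zero_le_power)
  qed
  then show ?thesis using C(1) by (intro exI[of _ C]) auto
qed

lemma norm_axis_complex: "norm (axis i (t::complex) :: complex ^ 'n::finite) = norm t"
proof -
  have "L2_set (\<lambda>k. norm ((axis i t :: complex ^ 'n) $ k)) UNIV
      = sqrt (\<Sum>k\<in>UNIV. if k = i then (norm t)\<^sup>2 else 0)"
    unfolding L2_set_def by (rule arg_cong[where f = sqrt], rule sum.cong) (auto simp: axis_def)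
  then show ?thesis by (simp add: norm_vec_def)
qed

text \<open>
  If the line misses the origin, the restriction of \<open>f\<close> is an entire function whose growth is that
  of a polynomial of degree \<open>p\<close>, and Liouville's theorem applies. If the line passes through the
  origin, it is a coordinate axis, and homogeneity determines \<open>f\<close> there.
\<close>

lemma H0_poly_on_line:
  fixes f :: "complex ^ 'n \<Rightarrow> complex"
  assumes f: "f \<in> H0 p"
  shows "\<exists>q :: complex poly. degree q \<le> p \<and> (\<forall>t. set_coord Z i t \<noteq> 0 \<longrightarrow> f (set_coord Z i t) = poly q t)"
proof (cases "set_coord Z i 0 = 0")
  case True
  have "f (set_coord Z i t) = poly (monom (f (axis i 1)) p) t" if "set_coord Z i t \<noteq> 0" for t
  proof -
    have "set_coord Z i t = axis i t" using set_coord_line[of Z i t] True by simp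
    also have "axis i t = t *s axis i 1" by (auto simp: axis_def vec_eq_iff)
    finally have e: "set_coord Z i t = t *s axis i 1" .
    with that have "t \<noteq> 0" "axis i (1::complex) \<noteq> 0" by auto
    then show ?thesis using H0_D(2)[OF f] e by (simp add: poly_monom mult.commute)
  qed
  then show ?thesis by (intro exI[of _ "monom (f (axis i 1)) p"]) (auto intro: degree_monom_le)
next
  case False
  define W where "W = set_coord Z i 0"
  define g where "g t = f (W + axis i t)" for t
  have nz: "W + axis i t \<noteq> 0" for t
  proof
    assume e: "W + axis i t = 0"
    have "W $ i = 0" by (simp add: W_def set_coord_nth)
    moreover have "(W + axis i t) $ i = 0" using e by simp
    ultimately have "t = 0" by (simp add: axis_def)
    with e False show False by (simp add: W_def)
  qed
  have hol: "g holomorphic_on UNIV"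
    unfolding holomorphic_on_def g_def using holomorphic_vec_line[OF H0_D(1)[OF f]] nz by auto
  obtain C where C: "C \<ge> 0" "\<And>Z. Z \<noteq> 0 \<Longrightarrow> norm (f Z) \<le> C * norm Z ^ p"
    using H0_growth[OF f] by blast
  have bd: "norm (g t) \<le> (C * 2 ^ p) * norm t ^ p" if "norm W \<le> norm t" for t
  proof -
    have "norm (W + axis i t) \<le> norm W + norm t"
      using norm_triangle_ineq[of W "axis i t"] by (simp add: norm_axis_complex)
    also have "\<dots> \<le> 2 * norm t" using that by simp
    finally have "norm (W + axis i t) ^ p \<le> (2 * norm t) ^ p" by (rule power_mono) simp
    then have "C * norm (W + axis i t) ^ p \<le> C * (2 * norm t) ^ p" using C(1) by (rule mult_left_mono)
    then show ?thesis using C(2)[OF nz, of t] unfolding g_def by (simp add: power_mult_distrib mult.assoc)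
  qed
  define q where "q = (\<Sum>k\<le>p. monom ((deriv ^^ k) g 0 / fact k) k)"
  have "degree q \<le> p"
    unfolding q_def by (rule degree_sum_le) (auto intro: order_trans[OF degree_monom_le])
  moreover have "f (set_coord Z i t) = poly q t" for t
  proof -
    have "f (set_coord Z i t) = g t" using set_coord_line[of Z i t] by (simp add: g_def W_def)
    also have "g t = poly q t"
      using Liouville_polynomial[OF hol bd] by (simp add: q_def poly_sum poly_monom)
    finally show ?thesis .
  qed
  ultimately show ?thesis by blast
qed

lemma H0_interpolation:
  assumes l: "\<forall>q. degree q \<le> p \<longrightarrow>
     (\<forall>t. poly q t = (\<Sum>j\<in>{1..p+1}. poly (l j) t * poly q (of_nat j)))"
    and f: "f \<in> H0 p" and Z: "Z \<noteq> 0"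
  shows "f Z = (\<Sum>j\<in>{1..p+1}. poly (l j) (Z $ i) * f (set_coord Z i (of_nat j)))"
proof -
  obtain q where q: "degree q \<le> p" "\<And>t. set_coord Z i t \<noteq> 0 \<Longrightarrow> f (set_coord Z i t) = poly q t"
    using H0_poly_on_line[OF f] by blast
  have "f Z = poly q (Z $ i)" using q(2)[of "Z $ i"] Z by (simp add: set_coord_same)
  also have "\<dots> = (\<Sum>j\<in>{1..p+1}. poly (l j) (Z $ i) * poly q (of_nat j))"
    using l q(1) by blast
  also have "\<dots> = (\<Sum>j\<in>{1..p+1}. poly (l j) (Z $ i) * f (set_coord Z i (of_nat j)))"
  proof (rule sum.cong)
    fix j assume "j \<in> {1..p+1}"
    then have "set_coord Z i (of_nat j) $ i \<noteq> 0" by (simp add: set_coord_nth)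
    then have "set_coord Z i (of_nat j) \<noteq> 0" by auto
    then show "poly (l j) (Z $ i) * poly q (of_nat j) = poly (l j) (Z $ i) * f (set_coord Z i (of_nat j))"
      using q(2) by simp
  qed simp
  finally show ?thesis .
qed

text \<open>
  Interpolation in one coordinate after the other writes \<open>f\<close> as a polynomial in the coordinates of
  a growing set \<open>S\<close>, the remaining ones being frozen at those of a vector \<open>W\<close>.
\<close>

lemma H0_polyfun:
  fixes f :: "complex ^ 'n \<Rightarrow> complex"
  assumes f: "f \<in> H0 p"
  shows "\<exists>P\<in>polyfun. \<forall>Z. Z \<noteq> 0 \<longrightarrow> f Z = P Z"
proof -
  obtain l :: "nat \<Rightarrow> complex poly" where l: "\<forall>q. degree q \<le> p \<longrightarrow>
     (\<forall>t. poly q t = (\<Sum>j\<in>{1..p+1}. poly (l j) t * poly q (of_nat j)))"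
    using lagrange_interpolation by blast
  have "\<exists>P\<in>polyfun. \<forall>Z. Z \<noteq> 0 \<longrightarrow> (\<forall>k. k \<notin> S \<longrightarrow> Z $ k = W $ k) \<longrightarrow> f Z = P Z" for S W
    using finite[of S]
  proof (induction S arbitrary: W rule: finite_induct)
    case empty
    show ?case by (rule bexI[OF _ polyfun.const[of "f W"]]) (metis empty_iff vec_eq_iff)
  next
    case (insert i S)
    obtain P where P: "\<And>j. P j \<in> polyfun"
      "\<And>j Z. Z \<noteq> 0 \<Longrightarrow> (\<forall>k. k \<notin> S \<longrightarrow> Z $ k = set_coord W i (of_nat j) $ k) \<Longrightarrow> f Z = P j Z"
      using insert.IH[of "set_coord W i (of_nat _)"] by metis
    define Q where "Q = (\<Sum>j\<in>{1..p+1}. (\<lambda>Z. poly (l j) (Z $ i)) * (\<lambda>Z. P j (set_coord Z i (of_nat j))))"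
    have "Q \<in> polyfun"
      unfolding Q_def by (intro polyfun_intros polyfun_poly polyfun_set_coord P)
    moreover have "f Z = Q Z" if Z: "Z \<noteq> 0" "\<forall>k. k \<notin> insert i S \<longrightarrow> Z $ k = W $ k" for Z
    proof -
      have "f (set_coord Z i (of_nat j)) = P j (set_coord Z i (of_nat j))" if "j \<in> {1..p+1}" for j
      proof (rule P(2))
        have "set_coord Z i (of_nat j) $ i \<noteq> 0" using that by (simp add: set_coord_nth)
        then show "set_coord Z i (of_nat j) \<noteq> 0" by auto
      qed (use Z in \<open>auto simp: set_coord_nth\<close>)
      then show ?thesis
        using H0_interpolation[OF l f Z(1), of i] unfolding Q_def by (simp add: sum_fun_apply)
    qed
    ultimately show ?case by blast
  qed
  from this[of UNIV] show ?thesis by simp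
qed

theorem H0_eq_cut: "H0 p = cut ` {P \<in> polyfun. homogeneous (int p) P}"
proof (intro equalityI subsetI)
  fix f :: "complex ^ 'n \<Rightarrow> complex" assume f: "f \<in> H0 p"
  then obtain P where P: "P \<in> polyfun" "\<And>Z. Z \<noteq> 0 \<Longrightarrow> f Z = P Z" using H0_polyfun by blast
  have "homogeneous (int p) P"
    unfolding homogeneous_def
  proof (intro allI impI)
    fix Z and c :: complex assume c: "c \<noteq> 0"
    have "(\<lambda>Z. P (c *s Z)) = (\<lambda>_. c ^ p) * P"
    proof (rule polyfun_eqI)
      fix Z :: "complex ^ 'n" assume "Z \<noteq> 0"
      then show "P (c *s Z) = ((\<lambda>_. c ^ p) * P) Z"
        using H0_D(2)[OF f, of Z c] c P(2)[of Z] P(2)[of "c *s Z"] by simp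
    qed (auto intro: polyfun_scale polyfun_intros P)
    then show "P (c *s Z) = c powi int p * P Z" by (simp add: fun_eq_iff)
  qed
  moreover have "f = cut P" using P(2) H0_D(3)[OF f] by (auto simp: cut_def)
  ultimately show "f \<in> cut ` {P \<in> polyfun. homogeneous (int p) P}" using P(1) by blast
next
  fix f :: "complex ^ 'n \<Rightarrow> complex" assume "f \<in> cut ` {P \<in> polyfun. homogeneous (int p) P}"
  then obtain P where P: "P \<in> polyfun" "homogeneous (int p) P" "f = cut P" by blast
  have "\<exists>D. (f has_derivative D) (at Z) \<and> (\<forall>c v. D (c *s v) = c * D v)" if "Z \<noteq> 0" for Z
  proof -
    obtain D where D: "(P has_derivative D) (at Z)" "\<forall>c v. D (c *s v) = c * D v"
      using polyfun_complex_differentiable[OF P(1)] by blast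
    have "(f has_derivative D) (at Z)"
      by (rule has_derivative_transform_within_open[OF D(1), of "- {0}"])
         (use that in \<open>auto simp: P(3) cut_def\<close>)
    then show ?thesis using D(2) by blast
  qed
  moreover have "f (c *s Z) = c powi int p * f Z" if "Z \<noteq> 0" "c \<noteq> 0" for Z c
    using that P(2) unfolding P(3) cut_def homogeneous_def by simp
  ultimately show "f \<in> H0 p"
    unfolding H0_def sections_def holomorphic_vec_def using P(3) by (auto simp: cut_def)
qed


section \<open>The bidifferential operators without derivatives of coefficients\<close>

lemma sum_PiE_atLeast1_Suc:
  "(\<Sum>a\<in>PiE {1..Suc k} T. F a) = (\<Sum>x\<in>T (Suc k). \<Sum>a\<in>PiE {1..k} T. F (a(Suc k := x)))"
proof -
  have "{1..Suc k} = insert (Suc k) {1..k}" by auto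
  then have "PiE {1..Suc k} T = (\<lambda>(x, a). a(Suc k := x)) ` (T (Suc k) \<times> PiE {1..k} T)"
    by (simp add: PiE_insert_eq)
  moreover have "inj_on (\<lambda>(x, a). a(Suc k := x)) (T (Suc k) \<times> PiE {1..k} T)"
    by (rule inj_combinator) simp
  ultimately have "(\<Sum>a\<in>PiE {1..Suc k} T. F a)
      = (\<Sum>(x, a)\<in>T (Suc k) \<times> PiE {1..k} T. F (a(Suc k := x)))"
    by (simp add: sum.reindex split_def)
  then show ?thesis by (simp add: sum.cartesian_product)
qed

lemma normal_product_0: "normal_product \<Lambda> 0 f g = f * g"
  by (rule ext) (simp add: normal_product_def pds_def)

text \<open>
  The recursion that replaces multi-indices from here on. It peels off the last pair of indices,
  because \<^const>\<open>pds\<close> applies the last derivative of a list first.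
\<close>

lemma normal_product_Suc:
  fixes \<Lambda> :: "'n::finite \<Rightarrow> 'n \<Rightarrow> complex ^ 'n \<Rightarrow> complex"
  shows "normal_product \<Lambda> (Suc k) f g
    = (\<Sum>x\<in>UNIV. \<Sum>y\<in>UNIV. \<Lambda> x y * normal_product \<Lambda> k (pd x f) (pd y g))"
proof
  fix Z
  have m: "map (a(Suc k := x)) [1..<Suc k + 1] = map a [1..<k+1] @ [x]" for a :: "nat \<Rightarrow> 'n" and x
    by (simp add: map_fun_upd)
  have p: "(\<Prod>i\<in>{1..Suc k}. \<Lambda> ((a(Suc k := x)) i) ((b(Suc k := y)) i) Z)
      = \<Lambda> x y Z * (\<Prod>i\<in>{1..k}. \<Lambda> (a i) (b i) Z)" for a b x y
  proof -
    have "(\<Prod>i\<in>{1..k}. \<Lambda> ((a(Suc k := x)) i) ((b(Suc k := y)) i) Z) = (\<Prod>i\<in>{1..k}. \<Lambda> (a i) (b i) Z)"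
      by (rule prod.cong) auto
    then show ?thesis by simp
  qed
  have "normal_product \<Lambda> (Suc k) f g Z
    = (\<Sum>x\<in>UNIV. \<Sum>a\<in>multi_indices k. \<Sum>y\<in>UNIV. \<Sum>b\<in>multi_indices k.
        \<Lambda> x y Z * ((\<Prod>i\<in>{1..k}. \<Lambda> (a i) (b i) Z)
          * pds (map a [1..<k+1]) (pd x f) Z * pds (map b [1..<k+1]) (pd y g) Z))"
    unfolding normal_product_def sum_PiE_atLeast1_Suc m p by (simp add: pds_def mult.assoc)
  also have "\<dots> = (\<Sum>x\<in>UNIV. \<Sum>y\<in>UNIV. \<Sum>a\<in>multi_indices k. \<Sum>b\<in>multi_indices k.
        \<Lambda> x y Z * ((\<Prod>i\<in>{1..k}. \<Lambda> (a i) (b i) Z)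
          * pds (map a [1..<k+1]) (pd x f) Z * pds (map b [1..<k+1]) (pd y g) Z))"
    by (rule sum.cong[OF refl], rule sum.swap)
  also have "\<dots> = (\<Sum>x\<in>UNIV. \<Sum>y\<in>UNIV. \<Lambda> x y * normal_product \<Lambda> k (pd x f) (pd y g)) Z"
    by (simp add: sum_fun_apply normal_product_def sum_distrib_left)
  finally show "normal_product \<Lambda> (Suc k) f g Z
    = (\<Sum>x\<in>UNIV. \<Sum>y\<in>UNIV. \<Lambda> x y * normal_product \<Lambda> k (pd x f) (pd y g)) Z" .
qed

text \<open>
  Pascal's rule, in the form of a sum over the two ways of going from order \<open>n\<close> to order \<open>n + 1\<close>
  in a two-parameter family.
\<close>

lemma pascal_sum:
  fixes a :: "nat \<Rightarrow> nat \<Rightarrow> 'a::comm_semiring_1"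
  shows "(\<Sum>k\<le>Suc n. of_nat (Suc n choose k) * a k (Suc n - k))
    = (\<Sum>k\<le>n. of_nat (n choose k) * (a (Suc k) (n - k) + a k (Suc (n - k))))"
proof -
  have "(\<Sum>k\<le>n. of_nat (n choose k) * a k (Suc n - k))
      = (\<Sum>k\<le>Suc n. of_nat (n choose k) * a k (Suc n - k))" by (simp add: binomial_eq_0)
  also have "\<dots> = a 0 (Suc n) + (\<Sum>k\<le>n. of_nat (n choose Suc k) * a (Suc k) (n - k))"
    by (subst sum.atMost_Suc_shift) simp
  finally have 1: "(\<Sum>k\<le>n. of_nat (n choose k) * a k (Suc (n - k)))
      = a 0 (Suc n) + (\<Sum>k\<le>n. of_nat (n choose Suc k) * a (Suc k) (n - k))"
    by (simp add: Suc_diff_le)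
  have "(\<Sum>k\<le>Suc n. of_nat (Suc n choose k) * a k (Suc n - k))
      = a 0 (Suc n) + (\<Sum>k\<le>n. of_nat (Suc n choose Suc k) * a (Suc k) (n - k))"
    by (subst sum.atMost_Suc_shift) simp
  also have "\<dots> = (\<Sum>k\<le>n. of_nat (n choose k) * a (Suc k) (n - k))
      + (\<Sum>k\<le>n. of_nat (n choose k) * a k (Suc (n - k)))"
    unfolding 1 by (simp add: distrib_right sum.distrib add_ac)
  finally show ?thesis by (simp add: distrib_left sum.distrib)
qed

lemma neg_one_power_fun: "((- 1) ^ m :: 'a \<Rightarrow> complex) = (\<lambda>_. (- 1) ^ m)"
  by (induction m) (auto simp: fun_eq_iff)


section \<open>Bivectors whose coefficients are Casimirs\<close>

text \<open>
  The last assumption says that the Hamiltonian vector fields \<open>\<Lambda>\<^sup>d\<^sup>c \<partial>\<^sub>d\<close> of the coordinates annihilate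
  all the coefficients. It implies the Jacobi identity, and it makes the coefficients behave like
  constants wherever one of these vector fields acts on them.
\<close>

locale casimir_bivector =
  fixes \<Lambda> :: "'n::finite \<Rightarrow> 'n \<Rightarrow> complex ^ 'n \<Rightarrow> complex"
  assumes polyfun_coeff: "\<Lambda> a b \<in> polyfun"
    and skew_coeff: "\<Lambda> a b = - \<Lambda> b a"
    and casimir_coeff: "(\<Sum>d\<in>UNIV. \<Lambda> d c * pd d (\<Lambda> a b)) = 0"
begin

(* As rewrite rules these eta-expand operations on functions, which hides the ring structure. *)
declare plus_fun_apply [simp del] times_fun_apply [simp del] zero_fun_apply [simp del] one_fun_apply [simp del]
  of_nat_fun_apply [simp del]

abbreviation N :: "nat \<Rightarrow> (complex ^ 'n \<Rightarrow> complex) \<Rightarrow> (complex ^ 'n \<Rightarrow> complex) \<Rightarrow> complex ^ 'n \<Rightarrow> complex" where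
  "N \<equiv> normal_product \<Lambda>"

text \<open>
  Up to sign, the Hamiltonian vector field of the coordinate \<open>z\<^sub>c\<close>.
\<close>

definition ham :: "'n \<Rightarrow> (complex ^ 'n \<Rightarrow> complex) \<Rightarrow> complex ^ 'n \<Rightarrow> complex" where
  "ham c f = (\<Sum>d\<in>UNIV. \<Lambda> d c * pd d f)"

definition casimirs :: "(complex ^ 'n \<Rightarrow> complex) set" where
  "casimirs = {u \<in> polyfun. \<forall>c. ham c u = 0}"

lemma polyfun_ham: "f \<in> polyfun \<Longrightarrow> ham c f \<in> polyfun"
  unfolding ham_def by (intro polyfun_intros polyfun_coeff polyfun_pd)

lemma ham_mult: "f \<in> polyfun \<Longrightarrow> g \<in> polyfun \<Longrightarrow> ham c (f * g) = ham c f * g + f * ham c g"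
  unfolding ham_def
  by (simp add: pd_mult sum.distrib[symmetric] sum_distrib_left sum_distrib_right algebra_simps)

lemma ham_sum: "(\<And>j. j \<in> A \<Longrightarrow> f j \<in> polyfun) \<Longrightarrow> ham c (sum f A) = (\<Sum>j\<in>A. ham c (f j))"
  unfolding ham_def by (subst sum.swap) (simp add: pd_sum sum_distrib_left)

lemma coeff_casimir: "\<Lambda> a b \<in> casimirs"
  unfolding casimirs_def ham_def using polyfun_coeff casimir_coeff by simp

lemma const_casimir: "(\<lambda>_. c) \<in> casimirs"
  unfolding casimirs_def ham_def by (simp add: polyfun.const)

lemma polyfun_N: "f \<in> polyfun \<Longrightarrow> g \<in> polyfun \<Longrightarrow> N k f g \<in> polyfun"
  by (induction k arbitrary: f g)
     (auto simp: normal_product_0 normal_product_Suc intro!: polyfun_intros polyfun_coeff polyfun_pd)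

lemma N_zero_left: "N k 0 g = 0"
  by (induction k arbitrary: g) (simp_all add: normal_product_0 normal_product_Suc)

lemma N_add_left:
  "f \<in> polyfun \<Longrightarrow> f' \<in> polyfun \<Longrightarrow> g \<in> polyfun \<Longrightarrow> N k (f + f') g = N k f g + N k f' g"
  by (induction k arbitrary: f f' g)
     (simp_all add: normal_product_0 normal_product_Suc pd_add polyfun_pd distrib_left distrib_right
        sum.distrib)

lemma N_sum_left:
  "(\<And>j. j \<in> A \<Longrightarrow> f j \<in> polyfun) \<Longrightarrow> g \<in> polyfun \<Longrightarrow> N k (sum f A) g = (\<Sum>j\<in>A. N k (f j) g)"
  by (induction A rule: infinite_finite_induct)
     (simp_all add: N_zero_left N_add_left polyfun_sum)

lemma N_skew: "N k f g = (- 1) ^ k * N k g f"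
proof (induction k arbitrary: f g)
  case 0
  show ?case by (simp add: normal_product_0 mult.commute)
next
  case (Suc k)
  have "N (Suc k) f g = (\<Sum>y\<in>UNIV. \<Sum>x\<in>UNIV. \<Lambda> x y * N k (pd x f) (pd y g))"
    unfolding normal_product_Suc by (rule sum.swap)
  also have "\<dots> = (\<Sum>y\<in>UNIV. \<Sum>x\<in>UNIV. (- 1) ^ Suc k * (\<Lambda> y x * N k (pd y g) (pd x f)))"
  proof (intro sum.cong refl)
    fix x y
    show "\<Lambda> x y * N k (pd x f) (pd y g) = (- 1) ^ Suc k * (\<Lambda> y x * N k (pd y g) (pd x f))"
      unfolding Suc.IH[of "pd x f"] by (subst skew_coeff) (simp add: algebra_simps)
  qed
  also have "\<dots> = (- 1) ^ Suc k * N (Suc k) g f"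
    by (simp add: normal_product_Suc sum_distrib_left)
  finally show ?case .
qed

text \<open>
  Linearity over the Casimirs at order \<open>k\<close> moves the coefficients into the first argument, which
  turns the first derivatives into Hamiltonian vector fields. This in turn gives linearity over the
  Casimirs at order \<open>k + 1\<close>, because a vector field that annihilates \<open>u\<close> commutes with
  multiplication by \<open>u\<close>. The next lemma runs this induction.
\<close>

lemma N_Suc_if_casimir_linear:
  assumes "\<And>u f g. u \<in> casimirs \<Longrightarrow> f \<in> polyfun \<Longrightarrow> g \<in> polyfun \<Longrightarrow> N k (u * f) g = u * N k f g"
    and "f \<in> polyfun" "g \<in> polyfun"
  shows "N (Suc k) f g = (\<Sum>y\<in>UNIV. N k (ham y f) (pd y g))"
proof -
  have "N (Suc k) f g = (\<Sum>y\<in>UNIV. \<Sum>x\<in>UNIV. N k (\<Lambda> x y * pd x f) (pd y g))"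
    unfolding normal_product_Suc by (subst sum.swap) (simp add: assms coeff_casimir polyfun_pd)
  then show ?thesis
    unfolding ham_def using assms
    by (simp add: N_sum_left polyfun_pd polyfun_coeff polyfun_mult)
qed

lemma N_casimir_left:
  "u \<in> casimirs \<Longrightarrow> f \<in> polyfun \<Longrightarrow> g \<in> polyfun \<Longrightarrow> N k (u * f) g = u * N k f g"
proof (induction k arbitrary: u f g)
  case 0
  then show ?case by (simp add: normal_product_0 mult.assoc)
next
  case (Suc k)
  have u: "u \<in> polyfun" "\<And>c. ham c u = 0" using Suc.prems by (auto simp: casimirs_def)
  have "N (Suc k) (u * f) g = (\<Sum>y\<in>UNIV. N k (ham y (u * f)) (pd y g))"
    by (rule N_Suc_if_casimir_linear[OF Suc.IH]) (use Suc.prems u in \<open>auto intro: polyfun_mult\<close>)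
  also have "\<dots> = (\<Sum>y\<in>UNIV. N k (u * ham y f) (pd y g))"
    using u Suc.prems by (simp add: ham_mult)
  also have "\<dots> = u * (\<Sum>y\<in>UNIV. N k (ham y f) (pd y g))"
    using Suc by (simp add: sum_distrib_left polyfun_ham polyfun_pd)
  also have "(\<Sum>y\<in>UNIV. N k (ham y f) (pd y g)) = N (Suc k) f g"
    by (rule N_Suc_if_casimir_linear[OF Suc.IH, symmetric]) (use Suc.prems in auto)
  finally show ?case .
qed

lemmas N_Suc_ham = N_Suc_if_casimir_linear[OF N_casimir_left]

text \<open>
  Leibniz' rule as if the coefficients inside \<^term>\<open>N k\<close> were constant. It fails for a single partial
  derivative; the contraction with \<open>\<Lambda>\<close> is essential.
\<close>

lemma ham_N:
  "f \<in> polyfun \<Longrightarrow> g \<in> polyfun \<Longrightarrow>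
     ham c (N k f g) = (\<Sum>d\<in>UNIV. \<Lambda> d c * (N k (pd d f) g + N k f (pd d g)))"
proof (induction k arbitrary: f g)
  case 0
  then show ?case by (simp add: normal_product_0 ham_def pd_mult)
next
  case (Suc k)
  have step: "ham c (\<Lambda> x y * N k (pd x f) (pd y g)) = (\<Sum>d\<in>UNIV. \<Lambda> d c *
     (\<Lambda> x y * N k (pd x (pd d f)) (pd y g) + \<Lambda> x y * N k (pd x f) (pd y (pd d g))))" for x y
  proof -
    have "ham c (\<Lambda> x y * N k (pd x f) (pd y g)) = \<Lambda> x y * ham c (N k (pd x f) (pd y g))"
      using coeff_casimir[of x y] Suc.prems
      by (simp add: ham_mult polyfun_coeff polyfun_N polyfun_pd casimirs_def)
    then show ?thesis
      using Suc.prems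
      by (simp add: Suc.IH polyfun_pd sum_distrib_left pd_commute[of f x] pd_commute[of g y] algebra_simps)
  qed
  have "ham c (N (Suc k) f g) = (\<Sum>x\<in>UNIV. \<Sum>y\<in>UNIV. ham c (\<Lambda> x y * N k (pd x f) (pd y g)))"
    using Suc.prems
    by (simp add: normal_product_Suc ham_sum polyfun_intros polyfun_coeff polyfun_N polyfun_pd)
  also have "\<dots> = (\<Sum>x\<in>UNIV. \<Sum>d\<in>UNIV. \<Sum>y\<in>UNIV. \<Lambda> d c *
     (\<Lambda> x y * N k (pd x (pd d f)) (pd y g) + \<Lambda> x y * N k (pd x f) (pd y (pd d g))))"
    unfolding step by (rule sum.cong[OF refl], rule sum.swap)
  also have "\<dots> = (\<Sum>d\<in>UNIV. \<Sum>x\<in>UNIV. \<Sum>y\<in>UNIV. \<Lambda> d c *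
     (\<Lambda> x y * N k (pd x (pd d f)) (pd y g) + \<Lambda> x y * N k (pd x f) (pd y (pd d g))))"
    by (rule sum.swap)
  finally show ?case
    by (simp add: normal_product_Suc sum_distrib_left sum.distrib distrib_left)
qed

text \<open>
  The order-\<open>n\<close> term of \<open>exp(\<Lambda>\<^sub>1\<^sub>2 + \<Lambda>\<^sub>1\<^sub>3 + \<Lambda>\<^sub>2\<^sub>3)\<close> applied to \<open>f \<otimes> g \<otimes> h\<close>, up to the factor \<open>1/n!\<close>, where
  \<open>\<Lambda>\<^sub>i\<^sub>j\<close> contracts derivatives of the \<open>i\<close>-th and the \<open>j\<close>-th factor and coefficients are not
  differentiated. Both bracketings of a triple star product equal it.
\<close>

fun triple_product :: "nat \<Rightarrow> (complex ^ 'n \<Rightarrow> complex) \<Rightarrow> (complex ^ 'n \<Rightarrow> complex) \<Rightarrow> (complex ^ 'n \<Rightarrow> complex)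
    \<Rightarrow> complex ^ 'n \<Rightarrow> complex" where
  "triple_product 0 f g h = f * g * h"
| "triple_product (Suc n) f g h = (\<Sum>x\<in>UNIV. \<Sum>y\<in>UNIV. \<Lambda> x y *
     (triple_product n (pd x f) (pd y g) h + triple_product n (pd x f) g (pd y h) + triple_product n f (pd x g) (pd y h)))"

text \<open>
  Raising the inner order applies \<open>\<Lambda>\<^sub>1\<^sub>2\<close> once more.
\<close>

lemma N_N_Suc_inner:
  assumes "f \<in> polyfun" "g \<in> polyfun" "h \<in> polyfun"
  shows "N k (N (Suc l) f g) h = (\<Sum>x\<in>UNIV. \<Sum>y\<in>UNIV. \<Lambda> x y * N k (N l (pd x f) (pd y g)) h)"
  unfolding normal_product_Suc[of \<Lambda> l] using assms
  by (simp add: N_sum_left N_casimir_left coeff_casimir polyfun_coeff polyfun_N polyfun_pd polyfun_intros)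

text \<open>
  Raising the outer order applies \<open>\<Lambda>\<^sub>1\<^sub>3 + \<Lambda>\<^sub>2\<^sub>3\<close> once more, because the new derivative falls on either
  factor of the inner product.
\<close>

lemma N_N_Suc_outer:
  assumes "f \<in> polyfun" "g \<in> polyfun" "h \<in> polyfun"
  shows "N (Suc k) (N l f g) h = (\<Sum>x\<in>UNIV. \<Sum>y\<in>UNIV. \<Lambda> x y *
    (N k (N l (pd x f) g) (pd y h) + N k (N l f (pd x g)) (pd y h)))"
proof -
  have "N (Suc k) (N l f g) h = (\<Sum>y\<in>UNIV. N k (ham y (N l f g)) (pd y h))"
    by (rule N_Suc_ham) (use assms polyfun_N in auto)
  also have "\<dots> = (\<Sum>y\<in>UNIV. \<Sum>x\<in>UNIV. \<Lambda> x y *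
    (N k (N l (pd x f) g) (pd y h) + N k (N l f (pd x g)) (pd y h)))"
    using assms
    by (simp add: ham_N N_sum_left N_casimir_left N_add_left coeff_casimir polyfun_coeff polyfun_N
        polyfun_pd polyfun_intros)
  finally show ?thesis by (subst (asm) sum.swap)
qed

text \<open>
  The binomial expansion of \<open>(\<Lambda>\<^sub>1\<^sub>2 + (\<Lambda>\<^sub>1\<^sub>3 + \<Lambda>\<^sub>2\<^sub>3))\<^sup>n\<close>, by induction with Pascal's rule.
\<close>

lemma sum_N_N_left:
  "f \<in> polyfun \<Longrightarrow> g \<in> polyfun \<Longrightarrow> h \<in> polyfun \<Longrightarrow>
    (\<Sum>k\<le>n. of_nat (n choose k) * N k (N (n - k) f g) h) = triple_product n f g h"
proof (induction n arbitrary: f g h)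
  case 0
  then show ?case by (simp add: normal_product_0)
next
  case (Suc n)
  have "(\<Sum>k\<le>Suc n. of_nat (Suc n choose k) * N k (N (Suc n - k) f g) h)
     = (\<Sum>k\<le>n. of_nat (n choose k) * (N (Suc k) (N (n - k) f g) h + N k (N (Suc (n - k)) f g) h))"
    by (rule pascal_sum[of n "\<lambda>k l. N k (N l f g) h"])
  also have "\<dots> = (\<Sum>k\<le>n. \<Sum>x\<in>UNIV. \<Sum>y\<in>UNIV. \<Lambda> x y * (of_nat (n choose k) *
      (N k (N (n - k) (pd x f) (pd y g)) h + N k (N (n - k) (pd x f) g) (pd y h)
        + N k (N (n - k) f (pd x g)) (pd y h))))"
    using Suc.prems
    by (simp add: N_N_Suc_inner N_N_Suc_outer sum_distrib_left sum.distrib[symmetric] algebra_simps)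
  also have "\<dots> = (\<Sum>x\<in>UNIV. \<Sum>y\<in>UNIV. \<Sum>k\<le>n. \<Lambda> x y * (of_nat (n choose k) *
      (N k (N (n - k) (pd x f) (pd y g)) h + N k (N (n - k) (pd x f) g) (pd y h)
        + N k (N (n - k) f (pd x g)) (pd y h))))"
    by (subst sum.swap, rule sum.cong[OF refl], rule sum.swap)
  also have "\<dots> = triple_product (Suc n) f g h"
    using Suc.prems
    by (simp add: Suc.IH[symmetric] polyfun_pd sum_distrib_left[symmetric] sum.distrib distrib_left)
  finally show ?case .
qed

lemma triple_product_skew: "triple_product n h g f = (- 1) ^ n * triple_product n f g h"
proof (induction n arbitrary: f g h)
  case (Suc n)
  have "triple_product (Suc n) h g f = (\<Sum>y\<in>UNIV. \<Sum>x\<in>UNIV. \<Lambda> x y *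
     (triple_product n (pd x h) (pd y g) f + triple_product n (pd x h) g (pd y f) + triple_product n h (pd x g) (pd y f)))"
    unfolding triple_product.simps by (rule sum.swap)
  also have "\<dots> = (\<Sum>y\<in>UNIV. \<Sum>x\<in>UNIV. (- 1) ^ Suc n * (\<Lambda> y x *
     (triple_product n (pd y f) (pd x g) h + triple_product n (pd y f) g (pd x h) + triple_product n f (pd y g) (pd x h))))"
  proof (intro sum.cong refl)
    fix x y
    show "\<Lambda> x y * (triple_product n (pd x h) (pd y g) f + triple_product n (pd x h) g (pd y f) + triple_product n h (pd x g) (pd y f))
      = (- 1) ^ Suc n * (\<Lambda> y x *
     (triple_product n (pd y f) (pd x g) h + triple_product n (pd y f) g (pd x h) + triple_product n f (pd y g) (pd x h)))"
      unfolding Suc.IH[of f] Suc.IH[of "pd y f"] by (subst skew_coeff) (simp add: algebra_simps)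
  qed
  also have "\<dots> = (- 1) ^ Suc n * triple_product (Suc n) f g h" by (simp add: sum_distrib_left)
  finally show ?case .
qed (simp add: mult_ac)

text \<open>
  Skew symmetry reverses the order of all the factors at the cost of the sign \<open>(-1)\<^sup>n\<close> on both
  sides, so this is the other bracketing.
\<close>

lemma sum_N_N_right:
  assumes "f \<in> polyfun" "g \<in> polyfun" "h \<in> polyfun"
  shows "(\<Sum>k\<le>n. of_nat (n choose k) * N k f (N (n - k) g h)) = triple_product n f g h"
proof -
  have "N k f (N (n - k) g h) = (- 1) ^ n * N k (N (n - k) h g) f" if "k \<le> n" for k
  proof -
    have "N k f (N (n - k) g h) = (- 1) ^ k * N k ((- 1) ^ (n - k) * N (n - k) h g) f"
      using N_skew[of k f] N_skew[of "n - k" g h] by simp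
    also have "N k ((- 1) ^ (n - k) * N (n - k) h g) f = (- 1) ^ (n - k) * N k (N (n - k) h g) f"
      unfolding neg_one_power_fun
      by (rule N_casimir_left[OF const_casimir]) (use assms polyfun_N in auto)
    also have "(- 1) ^ k * ((- 1) ^ (n - k) * N k (N (n - k) h g) f) = (- 1) ^ n * N k (N (n - k) h g) f"
      using that by (simp add: mult.assoc[symmetric] power_add[symmetric])
    finally show ?thesis .
  qed
  then have "(\<Sum>k\<le>n. of_nat (n choose k) * N k f (N (n - k) g h))
      = (- 1) ^ n * (\<Sum>k\<le>n. of_nat (n choose k) * N k (N (n - k) h g) f)"
    by (simp add: sum_distrib_left mult_ac)
  also have "\<dots> = (- 1) ^ n * triple_product n h g f" using sum_N_N_left assms by simp
  also have "\<dots> = triple_product n f g h" unfolding triple_product_skew[of n h]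
    by (simp add: mult.assoc[symmetric] power_add[symmetric])
  finally show ?thesis .
qed

text \<open>
  Each order contributes degree \<open>2\<close> from the coefficient and \<open>-1\<close> from each of the two derivatives.
\<close>

lemma N_homogeneous:
  assumes \<Lambda>: "\<And>a b. homogeneous 2 (\<Lambda> a b)"
  shows "f \<in> polyfun \<Longrightarrow> g \<in> polyfun \<Longrightarrow> homogeneous p f \<Longrightarrow> homogeneous q g \<Longrightarrow>
     homogeneous (p + q) (N k f g)"
proof (induction k arbitrary: f g p q)
  case 0
  then show ?case by (auto simp: homogeneous_def normal_product_0 power_int_add times_fun_apply)
next
  case (Suc k)
  have "\<Lambda> x y (c *s Z) * N k (pd x f) (pd y g) (c *s Z) = c powi (p + q) * (\<Lambda> x y Z * N k (pd x f) (pd y g) Z)"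
    if c: "c \<noteq> 0" for x y c Z
  proof -
    have "homogeneous ((p - 1) + (q - 1)) (N k (pd x f) (pd y g))"
      by (intro Suc.IH polyfun_pd homogeneous_pd Suc.prems)
    then have "N k (pd x f) (pd y g) (c *s Z) = c powi (p + q - 2) * N k (pd x f) (pd y g) Z"
      using c by (simp add: homogeneous_def)
    moreover have "\<Lambda> x y (c *s Z) = c powi 2 * \<Lambda> x y Z" using \<Lambda> c unfolding homogeneous_def by blast
    moreover have "c powi (p + q) = c powi 2 * c powi (p + q - 2)"
      using c power_int_add[of c 2 "p + q - 2"] by simp
    ultimately show ?thesis by simp
  qed
  then show ?case
    unfolding homogeneous_def normal_product_Suc by (simp add: sum_fun_apply sum_distrib_left times_fun_apply)
qed

lemma N_eq_0:
  "f \<in> polyfun \<Longrightarrow> homogeneous p f \<Longrightarrow> p < int k \<Longrightarrow> N k f g = 0"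
proof (induction k arbitrary: f g p)
  case 0
  then have "f = 0" using homogeneous_neg_zero by auto
  then show ?case by (simp add: normal_product_0)
next
  case (Suc k)
  have "N k (pd x f) (pd y g) = 0" for x y
    by (rule Suc.IH[OF polyfun_pd homogeneous_pd]) (use Suc.prems in auto)
  then show ?case by (simp add: normal_product_Suc)
qed

end


section \<open>The arrow condition and the Jacobi identity give Casimirs\<close>

text \<open>
  The left derivative of the second bracket falls on \<open>f\<close> or on the first coefficient, the right
  derivative of the first bracket falls on \<open>g\<close> or on the second coefficient. Primed indices belong
  to the first bracket.
\<close>

lemma arrow_product_2:
  fixes \<Lambda> :: "'n::finite \<Rightarrow> 'n \<Rightarrow> complex ^ 'n \<Rightarrow> complex"
  shows "arrow_product \<Lambda> 2 f g Z = (\<Sum>a\<in>UNIV. \<Sum>a'\<in>UNIV. \<Sum>b\<in>UNIV. \<Sum>b'\<in>UNIV.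
     pd a' (pd a f) Z * \<Lambda> a' b' Z * \<Lambda> a b Z * pd b' (pd b g) Z
   + pd a' (pd a f) Z * \<Lambda> a' b' Z * pd b' (\<Lambda> a b) Z * pd b g Z
   + pd a' f Z * pd a (\<Lambda> a' b') Z * \<Lambda> a b Z * pd b' (pd b g) Z
   + pd a' f Z * pd a (\<Lambda> a' b') Z * pd b' (\<Lambda> a b) Z * pd b g Z)"
proof -
  have ranges: "[1..<2 + 1] = [1, 2::nat]" "{0..2 + 1} = {0, 1, 2, 3 :: nat}"
    "{0..<2} = {0, 1 :: nat}" "{0..<1} = {0 :: nat}"
    "{1<..2 + 1} = {2, 3 :: nat}" "{2<..2 + 1} = {3 :: nat}"
    by (auto simp: upt_rec)
  have PiE2: "(\<Sum>a\<in>PiE {1..2} T. F a)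
      = (\<Sum>x\<in>T 2. \<Sum>y\<in>T 1. F ((\<lambda>_. undefined)(1 := y, 2 := x)))"
    for T :: "nat \<Rightarrow> 'c set" and F :: "(nat \<Rightarrow> 'c) \<Rightarrow> complex"
  proof -
    have "(\<Sum>a\<in>PiE {1..Suc 0} T. G a) = (\<Sum>y\<in>T 1. G ((\<lambda>_. undefined)(1 := y)))"
      for G :: "(nat \<Rightarrow> 'c) \<Rightarrow> complex"
      using sum_PiE_atLeast1_Suc[of G 0 T] by (simp add: fun_upd_def)
    then show ?thesis
      using sum_PiE_atLeast1_Suc[of F 1 T] by (simp add: numeral_2_eq_2)
  qed
  show ?thesis
    unfolding arrow_product_def PiE2 ranges
    by (simp add: pds_def mult.assoc add_ac)
qed

lemma open_cone_UNIV: "open_cone (UNIV - {0 :: complex ^ 'n})"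
  unfolding open_cone_def by (auto simp: open_delete)

lemma coord_section: "(\<lambda>Z. Z $ i) \<in> sections 1 (UNIV - {0})"
  unfolding sections_def by (auto intro: polyfun_holomorphic_vec polyfun.intros)

lemma coord_mult_section: "(\<lambda>Z. Z $ i * Z $ j) \<in> sections 2 (UNIV - {0})"
  unfolding sections_def
  by (auto intro!: polyfun_holomorphic_vec intro: polyfun.intros simp: power2_eq_square)

text \<open>
  In degree \<open>2\<close> the polynomial vanishes at the origin, so the section is a polynomial even there.
\<close>

lemma section_2_polyfun:
  assumes "f \<in> sections 2 (UNIV - {0})"
  shows "f \<in> polyfun" "homogeneous 2 f"
proof -
  have "f \<in> H0 2" using assms by (simp add: H0_def)
  then obtain P where P: "P \<in> polyfun" "homogeneous 2 P" "f = cut P"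
    unfolding H0_eq_cut by auto
  have "P (2 *s 0) = 2 powi 2 * P 0" using P(2) unfolding homogeneous_def by (metis zero_neq_numeral)
  then have "P 0 = 0" by simp
  then have "f = P" using P(3) by (auto simp: cut_def)
  then show "f \<in> polyfun" "homogeneous 2 f" using P by auto
qed

text \<open>
  Let \<open>t c a b\<close> be, up to sign, the derivative of \<open>\<Lambda>\<^sup>a\<^sup>b\<close> along the Hamiltonian vector field of \<open>z\<^sub>c\<close>. The arrow
  condition for \<open>k = 2\<close> with linear \<open>f\<close> and \<open>g\<close> leaves only the term \<open>B\<close> in which both coefficients
  are differentiated, so \<open>B = 0\<close>; with quadratic \<open>g\<close> it then says that \<open>t\<close> changes sign when its
  first and third argument are exchanged. As \<open>\<Lambda>\<close> is skew, \<open>t\<close> is totally antisymmetric. The Jacobi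
  identity for coordinates is the vanishing of its cyclic sum, which is \<open>3 t\<close>.
\<close>

lemma casimir_if_arrow_2_and_jacobi:
  fixes \<Lambda> :: "'n::finite \<Rightarrow> 'n \<Rightarrow> complex ^ 'n \<Rightarrow> complex"
  assumes poly: "\<And>a b. \<Lambda> a b \<in> polyfun"
    and skew: "\<And>a b. \<Lambda> a b = - \<Lambda> b a"
    and jacobi: "\<And>a b c. bracket \<Lambda> (\<lambda>Z. Z $ a) (bracket \<Lambda> (\<lambda>Z. Z $ b) (\<lambda>Z. Z $ c)) Z
       + bracket \<Lambda> (\<lambda>Z. Z $ b) (bracket \<Lambda> (\<lambda>Z. Z $ c) (\<lambda>Z. Z $ a)) Z
       + bracket \<Lambda> (\<lambda>Z. Z $ c) (bracket \<Lambda> (\<lambda>Z. Z $ a) (\<lambda>Z. Z $ b)) Z = 0"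
    and arrow_linear: "\<And>a b. arrow_product \<Lambda> 2 (\<lambda>Z. Z $ a) (\<lambda>Z. Z $ b) Z
       = normal_product \<Lambda> 2 (\<lambda>Z. Z $ a) (\<lambda>Z. Z $ b) Z"
    and arrow_quadratic: "\<And>a b c. arrow_product \<Lambda> 2 (\<lambda>Z. Z $ a) (\<lambda>Z. Z $ b * Z $ c) Z
       = normal_product \<Lambda> 2 (\<lambda>Z. Z $ a) (\<lambda>Z. Z $ b * Z $ c) Z"
  shows "(\<Sum>d\<in>UNIV. \<Lambda> d c Z * pd d (\<Lambda> a b) Z) = 0"
proof -
  define t where "t c a b = (\<Sum>d\<in>UNIV. \<Lambda> d c Z * pd d (\<Lambda> a b) Z)" for a b c
  have pd_coord': "pd i (\<lambda>Z. Z $ j) = (\<lambda>_. of_bool (i = j))" for i j :: 'n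
    by (auto simp: pd_coord)
  have pd_quad: "pd i (\<lambda>Z. Z $ b * Z $ c) = (\<lambda>Z. of_bool (i = b) * Z $ c + of_bool (i = c) * Z $ b)"
    for i b c :: 'n
    using pd_mult[OF polyfun.coord[of b] polyfun.coord[of c], of i]
    by (simp add: times_fun_def plus_fun_def pd_coord' mult.commute)
  have pd_quad2: "pd j (pd i (\<lambda>Z. Z $ b * Z $ c))
      = (\<lambda>_. of_bool (i = b) * of_bool (j = c) + of_bool (i = c) * of_bool (j = b))" for i j b c :: 'n
  proof -
    have "pd j ((\<lambda>_. of_bool (i = b)) * (\<lambda>Z. Z $ c) + (\<lambda>_. of_bool (i = c)) * (\<lambda>Z. Z $ b))
      = (\<lambda>_. of_bool (i = b) * of_bool (j = c) + of_bool (i = c) * of_bool (j = b))"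
      by (simp add: pd_add pd_mult polyfun_intros pd_coord' fun_eq_iff)
    then show ?thesis by (simp add: pd_quad times_fun_def plus_fun_def)
  qed
  have normal_0: "normal_product \<Lambda> 2 (\<lambda>Z. Z $ a) g Z = 0" for a g
    by (simp add: numeral_2_eq_2 normal_product_Suc normal_product_0 pd_coord' sum_fun_apply)
  have skew_Z: "\<Lambda> a b Z = - \<Lambda> b a Z" for a b Z using skew[of a b] by (metis uminus_apply)
  have arrow: "arrow_product \<Lambda> 2 (\<lambda>Z. Z $ a) g Z = (\<Sum>d\<in>UNIV. \<Sum>b\<in>UNIV. \<Sum>b'\<in>UNIV.
     pd d (\<Lambda> a b') Z * \<Lambda> d b Z * pd b' (pd b g) Z
   + pd d (\<Lambda> a b') Z * pd b' (\<Lambda> d b) Z * pd b g Z)" (is "_ = (\<Sum>d\<in>UNIV. ?H d)") for a g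
  proof -
    have "arrow_product \<Lambda> 2 (\<lambda>Z. Z $ a) g Z = (\<Sum>d\<in>UNIV. \<Sum>a'\<in>UNIV. if a' = a then ?H d else 0)"
      unfolding arrow_product_2 pd_coord' by (intro sum.cong refl) auto
    then show ?thesis by simp
  qed
  have delta: "(\<Sum>b\<in>UNIV. F b * of_bool (b = c)) = F c" for F :: "'n \<Rightarrow> complex" and c
    by simp
  define B where "B a b = (\<Sum>d\<in>UNIV. \<Sum>e\<in>UNIV. pd d (\<Lambda> a e) Z * pd e (\<Lambda> d b) Z)" for a b
  have B: "B a b = 0" for a b
  proof -
    have "arrow_product \<Lambda> 2 (\<lambda>Z. Z $ a) (\<lambda>Z. Z $ b) Z = B a b"
      unfolding arrow B_def by (simp add: pd_coord' sum_distrib_right[symmetric])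
    then show ?thesis using arrow_linear normal_0 by metis
  qed
  \<comment> \<open>second derivatives of \<open>z\<^sub>b z\<^sub>c\<close> give \<open>t\<close>, first derivatives give multiples of \<open>B\<close>\<close>
  have t13: "t c a b = - t b a c" for a b c
  proof -
    let ?p = "\<lambda>d e. pd d (\<Lambda> a e) Z"
    have "(\<Sum>e\<in>UNIV. \<Sum>e'\<in>UNIV. ?p d e' * \<Lambda> d e Z * (of_bool (e = b) * of_bool (e' = c) + of_bool (e = c) * of_bool (e' = b)))
        = ?p d c * \<Lambda> d b Z + ?p d b * \<Lambda> d c Z" for d
    proof -
      have "(\<Sum>e\<in>UNIV. \<Sum>e'\<in>UNIV. ?p d e' * \<Lambda> d e Z * (of_bool (e = b) * of_bool (e' = c) + of_bool (e = c) * of_bool (e' = b)))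
        = (\<Sum>e\<in>UNIV. (\<Sum>e'\<in>UNIV. (?p d e' * \<Lambda> d e Z) * of_bool (e' = c)) * of_bool (e = b)
            + (\<Sum>e'\<in>UNIV. (?p d e' * \<Lambda> d e Z) * of_bool (e' = b)) * of_bool (e = c))"
        by (simp only: distrib_left sum.distrib sum_distrib_right sum_distrib_left mult_ac)
      then show ?thesis by (simp only: delta sum.distrib)
    qed
    moreover have "(\<Sum>e\<in>UNIV. \<Sum>e'\<in>UNIV. ?p d e' * pd e' (\<Lambda> d e) Z * (of_bool (e = b) * Z $ c + of_bool (e = c) * Z $ b))
        = (\<Sum>e\<in>UNIV. ?p d e * pd e (\<Lambda> d b) Z) * Z $ c + (\<Sum>e\<in>UNIV. ?p d e * pd e (\<Lambda> d c) Z) * Z $ b" for d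
    proof -
      have "(\<Sum>e\<in>UNIV. \<Sum>e'\<in>UNIV. ?p d e' * pd e' (\<Lambda> d e) Z * (of_bool (e = b) * Z $ c + of_bool (e = c) * Z $ b))
        = (\<Sum>e\<in>UNIV. ((\<Sum>e'\<in>UNIV. ?p d e' * pd e' (\<Lambda> d e) Z) * Z $ c) * of_bool (e = b)
           + ((\<Sum>e'\<in>UNIV. ?p d e' * pd e' (\<Lambda> d e) Z) * Z $ b) * of_bool (e = c))"
        by (simp only: distrib_left sum.distrib sum_distrib_right sum_distrib_left mult_ac)
      then show ?thesis by (simp only: delta sum.distrib)
    qed
    ultimately have "arrow_product \<Lambda> 2 (\<lambda>Z. Z $ a) (\<lambda>Z. Z $ b * Z $ c) Z
      = t c a b + t b a c + B a b * Z $ c + B a c * Z $ b"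
      unfolding arrow B_def t_def pd_quad2 sum.distrib
      unfolding pd_quad
      by (simp only: sum.distrib sum_distrib_right mult_ac add_ac) (simp only: sum_distrib_left)
    then have "t c a b + t b a c = 0" using arrow_quadratic[of a b c] normal_0 B by simp
    then show ?thesis by (simp add: add_eq_0_iff)
  qed
  have t23: "t c a b = - t c b a" for a b c
  proof -
    have "pd d (\<Lambda> a b) = - pd d (\<Lambda> b a)" for d
    proof -
      have "pd d (\<Lambda> a b + \<Lambda> b a) = 0" by (subst skew) simp
      then show ?thesis using pd_add[OF poly poly, of d a b b a] by (metis eq_neg_iff_add_eq_0)
    qed
    then show ?thesis unfolding t_def by (simp add: sum_negf)
  qed
  have bracket: "bracket \<Lambda> (\<lambda>Z. Z $ a) g Y = - (\<Sum>d\<in>UNIV. \<Lambda> d a Y * pd d g Y)" for a g Y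
  proof -
    have "bracket \<Lambda> (\<lambda>Z. Z $ a) g Y = (\<Sum>a'\<in>UNIV. if a' = a then \<Sum>d\<in>UNIV. \<Lambda> a d Y * pd d g Y else 0)"
      unfolding bracket_def pd_coord' by (intro sum.cong refl) auto
    also have "\<dots> = (\<Sum>d\<in>UNIV. \<Lambda> a d Y * pd d g Y)" by simp
    finally show ?thesis by (simp add: skew_Z[of a] sum_negf)
  qed
  have "bracket \<Lambda> (\<lambda>Z. Z $ b) (\<lambda>Z. Z $ c) = \<Lambda> b c" for b c
    by (rule ext) (simp add: bracket pd_coord' delta skew_Z[of b])
  then have "t a b c + t b c a + t c a b = 0"
    using jacobi[of a b c] by (simp add: bracket t_def add_eq_0_iff)
  moreover have "t b c a = t a b c" "t c a b = t a b c"
    using t13[of b c a] t23[of a c b] t13[of c a b] t23[of b a c] by simp_all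
  ultimately show ?thesis by (simp add: t_def)
qed


section \<open>The coefficients of the star product on sections\<close>

lemma normal_product_local:
  fixes \<Lambda> :: "'n::finite \<Rightarrow> 'n \<Rightarrow> complex ^ 'n \<Rightarrow> complex"
  assumes "\<And>Z. Z \<noteq> 0 \<Longrightarrow> f Z = f' Z" "\<And>Z. Z \<noteq> 0 \<Longrightarrow> g Z = g' Z" "Z \<noteq> 0"
  shows "normal_product \<Lambda> k f g Z = normal_product \<Lambda> k f' g' Z"
  using assms
proof (induction k arbitrary: f f' g g' Z)
  case (Suc k)
  have "normal_product \<Lambda> k (pd x f) (pd y g) Z = normal_product \<Lambda> k (pd x f') (pd y g') Z" for x y
    by (rule Suc.IH) (use Suc.prems pd_local in blast)+
  then show ?case by (simp add: normal_product_Suc sum_fun_apply)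
qed (simp add: normal_product_0)

text \<open>
  Reduces statements about star products of sections to the polynomials that define them.
\<close>

lemma star_coeff_cut:
  fixes \<Lambda> :: "'n::finite \<Rightarrow> 'n \<Rightarrow> complex ^ 'n \<Rightarrow> complex"
  shows "star_coeff \<Lambda> k (cut f) (cut g) = cut ((\<lambda>_. 1 / fact k * (1 / 2) ^ k) * normal_product \<Lambda> k f g)"
proof
  fix Z
  have "Z \<noteq> 0 \<Longrightarrow> normal_product \<Lambda> k (cut f) (cut g) Z = normal_product \<Lambda> k f g Z"
    by (rule normal_product_local) (simp_all add: cut_def)
  then show "star_coeff \<Lambda> k (cut f) (cut g) Z
      = cut ((\<lambda>_. 1 / fact k * (1 / 2) ^ k) * normal_product \<Lambda> k f g) Z"
    by (simp add: star_coeff_def cut_def)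
qed

lemma cut_add: "cut f + cut g = cut (f + g)"
  by (auto simp: cut_def)

lemma cut_scale: "(\<lambda>Z. c * cut f Z) = cut ((\<lambda>_. c) * f)"
  by (auto simp: cut_def)

lemma cut_sum: "(\<Sum>i\<in>A. cut (f i)) = cut (sum f A)"
  by (rule ext) (auto simp: cut_def sum_fun_apply)

lemma cut_zero [simp]: "cut 0 = 0"
  by (auto simp: cut_def)

lemma H0_E:
  assumes "f \<in> H0 p"
  obtains P where "P \<in> polyfun" "homogeneous (int p) P" "f = cut P"
  using assms unfolding H0_eq_cut by blast

lemma H0_add: "f \<in> H0 p \<Longrightarrow> g \<in> H0 p \<Longrightarrow> f + g \<in> H0 p"
  unfolding H0_eq_cut by (auto simp: cut_add homogeneous_def distrib_left intro!: imageI polyfun_intros)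

lemma H0_scale: "f \<in> H0 p \<Longrightarrow> (\<lambda>Z. c * f Z) \<in> H0 p"
  unfolding H0_eq_cut by (auto simp: cut_scale homogeneous_def intro!: imageI polyfun_intros)

lemma H0_zero: "0 \<in> H0 p"
  unfolding H0_eq_cut by (rule image_eqI[of _ _ 0]) (auto simp: homogeneous_def intro: polyfun_intros)

lemma H0_sum_closed: "(\<And>i. i \<in> A \<Longrightarrow> f i \<in> H0 p) \<Longrightarrow> sum f A \<in> H0 p"
  by (induction A rule: infinite_finite_induct) (auto intro: H0_add H0_zero)

text \<open>
  Both sides sum over all decompositions of \<open>m\<close> into three summands.
\<close>

lemma sum_assoc_reindex:
  fixes f :: "nat \<Rightarrow> nat \<Rightarrow> nat \<Rightarrow> 'a::comm_monoid_add"
  shows "(\<Sum>j\<le>m. \<Sum>i\<le>j. f i (j - i) (m - j)) = (\<Sum>i\<le>m. \<Sum>j\<le>m - i. f i j (m - i - j))"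
proof -
  have "(\<Sum>j\<le>m. \<Sum>i\<le>j. f i (j - i) (m - j)) = (\<Sum>(j, i)\<in>(SIGMA j:{..m}. {..j}). f i (j - i) (m - j))"
    by (simp add: sum.Sigma)
  also have "\<dots> = (\<Sum>(i, j)\<in>(SIGMA i:{..m}. {..m - i}). f i j (m - i - j))"
    by (rule sum.reindex_bij_witness[of _ "\<lambda>(i, j). (i + j, i)" "\<lambda>(j, i). (i, j - i)"]) auto
  finally show ?thesis by (simp add: sum.Sigma)
qed

text \<open>
  The double sum over \<open>k, l \<le> K\<close> lives in the triangle \<open>k + l \<le> 2K\<close>, where it can be arranged by
  total order.
\<close>

lemma sum_square_triangle:
  fixes a :: "nat \<Rightarrow> nat \<Rightarrow> complex"
  assumes "\<And>k l. K < k \<or> K < l \<Longrightarrow> a k l = 0"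
  shows "(\<Sum>k\<le>K. \<Sum>l\<le>K. a k l) = (\<Sum>n\<le>K+K. \<Sum>k\<le>n. a k (n - k))"
proof -
  have "(\<Sum>k\<le>K. \<Sum>l\<le>K. a k l) = (\<Sum>(k, l)\<in>{..K} \<times> {..K}. a k l)"
    by (simp add: sum.cartesian_product)
  also have "\<dots> = (\<Sum>(k, l)\<in>{(k, l). k + l \<le> K + K}. a k l)"
  proof (rule sum.mono_neutral_left)
    have "{(k, l). k + l \<le> K + K} \<subseteq> {..K + K} \<times> {..K + K}" by auto
    then show "finite {(k, l). k + l \<le> K + K}" by (rule finite_subset) simp
  qed (use assms in \<open>auto, (meson not_le)+\<close>)
  also have "\<dots> = (\<Sum>n\<le>K+K. \<Sum>k\<le>n. a k (n - k))" by (rule sum.triangle_reindex_eq)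
  finally show ?thesis .
qed

text \<open>
  Degree \<open>2\<close> of the coefficients is the statement that the biderivation has order zero.
\<close>

locale star_bivector = casimir_bivector \<Lambda>
  for \<Lambda> :: "'n::finite \<Rightarrow> 'n \<Rightarrow> complex ^ 'n \<Rightarrow> complex" +
  assumes homogeneous_coeff: "homogeneous 2 (\<Lambda> a b)"
begin

abbreviation C :: "nat \<Rightarrow> (complex ^ 'n \<Rightarrow> complex) \<Rightarrow> (complex ^ 'n \<Rightarrow> complex) \<Rightarrow> complex ^ 'n \<Rightarrow> complex" where
  "C \<equiv> star_coeff \<Lambda>"

lemma C_H0:
  assumes "f \<in> H0 p" "g \<in> H0 q"
  shows "C k f g \<in> H0 (p + q)"
proof -
  obtain P Q where PQ: "P \<in> polyfun" "homogeneous (int p) P" "f = cut P"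
    "Q \<in> polyfun" "homogeneous (int q) Q" "g = cut Q"
    using assms by (elim H0_E)
  have "(\<lambda>_. 1 / fact k * (1 / 2) ^ k) * N k P Q \<in> polyfun"
    by (intro polyfun_intros polyfun_N PQ)
  moreover have "homogeneous (int (p + q)) ((\<lambda>_. 1 / fact k * (1 / 2) ^ k) * N k P Q)"
    using N_homogeneous[OF homogeneous_coeff PQ(1,4,2,5), of k] by (simp add: homogeneous_def times_fun_apply)
  ultimately show ?thesis unfolding PQ(3,6) star_coeff_cut H0_eq_cut by blast
qed

lemma C_eq_0:
  assumes "f \<in> H0 p" "g \<in> H0 q" "p < k"
  shows "C k f g = 0"
proof -
  obtain P Q where PQ: "P \<in> polyfun" "homogeneous (int p) P" "f = cut P" "g = cut Q"
    using assms(1,2) by (elim H0_E)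
  have "N k P Q = 0" using N_eq_0 PQ assms(3) by (metis of_nat_less_iff)
  then show ?thesis unfolding PQ(3,4) star_coeff_cut by simp
qed

lemma C_add_left:
  assumes "f \<in> H0 p" "f' \<in> H0 p" "g \<in> H0 q"
  shows "C k (f + f') g = C k f g + C k f' g"
proof -
  obtain P P' Q where PQ: "P \<in> polyfun" "f = cut P" "P' \<in> polyfun" "f' = cut P'"
    "Q \<in> polyfun" "g = cut Q"
    using assms by (elim H0_E)
  show ?thesis unfolding PQ(2,4,6) cut_add star_coeff_cut
    by (simp only: N_add_left PQ distrib_left)
qed

lemma C_scale_left:
  assumes "f \<in> H0 p" "g \<in> H0 q"
  shows "C k (\<lambda>Z. c * f Z) g = (\<lambda>Z. c * C k f g Z)"
proof -
  obtain P Q where PQ: "P \<in> polyfun" "f = cut P" "Q \<in> polyfun" "g = cut Q"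
    using assms by (elim H0_E)
  show ?thesis unfolding PQ(2,4) cut_scale star_coeff_cut
    by (simp only: N_casimir_left const_casimir PQ mult.left_commute)
qed

lemma C_skew:
  assumes "f \<in> H0 p" "g \<in> H0 q"
  shows "C k f g = (\<lambda>Z. (- 1) ^ k * C k g f Z)"
proof -
  obtain P Q where PQ: "P \<in> polyfun" "f = cut P" "Q \<in> polyfun" "g = cut Q"
    using assms by (elim H0_E)
  show ?thesis unfolding PQ(2,4) star_coeff_cut cut_scale N_skew[of k P] neg_one_power_fun
    by (simp only: mult.left_commute)
qed

lemma C_add_right:
  assumes "f \<in> H0 p" "g \<in> H0 q" "g' \<in> H0 q"
  shows "C k f (g + g') = C k f g + C k f g'"
  unfolding C_skew[OF assms(1,2)] C_skew[OF assms(1,3)] C_skew[OF assms(1) H0_add[OF assms(2,3)]]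
    C_add_left[OF assms(2,3,1)]
  by (simp add: fun_eq_iff plus_fun_apply distrib_left)

lemma C_scale_right:
  assumes "f \<in> H0 p" "g \<in> H0 q"
  shows "C k f (\<lambda>Z. c * g Z) = (\<lambda>Z. c * C k f g Z)"
  unfolding C_skew[OF assms] C_skew[OF assms(1) H0_scale[OF assms(2)]] C_scale_left[OF assms(2,1)]
  by (simp add: fun_eq_iff)

lemma C_zero_left: "g \<in> H0 q \<Longrightarrow> C k 0 g = 0"
  using C_scale_left[OF H0_zero[of 0], of g q k 0] by (simp add: zero_fun_def)

lemma C_zero_right: "f \<in> H0 p \<Longrightarrow> C k f 0 = 0"
  using C_scale_right[OF _ H0_zero[of 0], of f p k 0] by (simp add: zero_fun_def)

lemma C_sum_left:
  assumes "\<And>i. i \<in> A \<Longrightarrow> f i \<in> H0 p" "g \<in> H0 q"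
  shows "C k (sum f A) g = (\<Sum>i\<in>A. C k (f i) g)"
  using assms(1)
proof (induction A rule: infinite_finite_induct)
  case (insert x A)
  then show ?case using assms(2) C_add_left[of "f x" p "sum f A" g q k] by (simp add: H0_sum_closed)
qed (use assms(2) in \<open>auto intro: C_zero_left\<close>)

lemma C_sum_right:
  assumes "f \<in> H0 p" "\<And>i. i \<in> A \<Longrightarrow> g i \<in> H0 q"
  shows "C k f (sum g A) = (\<Sum>i\<in>A. C k f (g i))"
  using assms(2)
proof (induction A rule: infinite_finite_induct)
  case (insert x A)
  then show ?case using assms(1) C_add_right[of f p "g x" q "sum g A" k] by (simp add: H0_sum_closed)
qed (use assms(1) in \<open>auto intro: C_zero_right\<close>)

text \<open>
  The weights turn the binomial sums into the coefficients of the star product: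
  \<open>1/k! \<cdot> 1/(n-k)! = (n choose k)/n!\<close>, and the powers of \<open>1/2\<close> multiply to \<open>(1/2)\<^sup>n\<close>.
\<close>

lemma C_assoc:
  assumes "f \<in> H0 p" "g \<in> H0 q" "h \<in> H0 r"
  shows "(\<Sum>k\<le>n. C k (C (n - k) f g) h) = (\<Sum>k\<le>n. C k f (C (n - k) g h))"
proof -
  obtain P Q R where PQR: "P \<in> polyfun" "f = cut P" "Q \<in> polyfun" "g = cut Q" "R \<in> polyfun" "h = cut R"
    using assms by (elim H0_E)
  let ?c = "\<lambda>k::nat. 1 / fact k * (1 / 2) ^ k :: complex"
  have c: "?c k * ?c (n - k) = ?c n * of_nat (n choose k)" if "k \<le> n" for k
  proof -
    have "(1 / 2) ^ k * (1 / 2) ^ (n - k) = ((1 / 2) ^ n :: complex)"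
      using that by (simp flip: power_add)
    moreover have "1 / fact k * (1 / fact (n - k)) = (1 / fact n * of_nat (n choose k) :: complex)"
      using binomial_fact[OF that, where 'a = complex] by simp
    moreover have "?c k * ?c (n - k) = (1 / fact k * (1 / fact (n - k))) * ((1 / 2) ^ k * (1 / 2) ^ (n - k))"
      by (simp only: mult_ac)
    ultimately show ?thesis by (simp only: mult_ac)
  qed
  have N_N: "(\<lambda>_. ?c k) * N k ((\<lambda>_. ?c (n - k)) * N (n - k) P Q) R
      = (\<lambda>_. ?c n) * (of_nat (n choose k) * N k (N (n - k) P Q) R)" if "k \<le> n" for k
  proof -
    have "N k ((\<lambda>_. ?c (n - k)) * N (n - k) P Q) R = (\<lambda>_. ?c (n - k)) * N k (N (n - k) P Q) R"
      by (rule N_casimir_left[OF const_casimir]) (use PQR polyfun_N in auto)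
    moreover have "?c k * (?c (n - k) * x) = ?c n * (of_nat (n choose k) * x)" for x
      using c[OF that] by (simp only: mult.assoc[symmetric])
    ultimately show ?thesis by (simp only: fun_eq_iff times_fun_apply of_nat_fun_apply simp_thms)
  qed
  have N_N': "(\<lambda>_. ?c k) * N k P ((\<lambda>_. ?c (n - k)) * N (n - k) Q R)
      = (\<lambda>_. ?c n) * (of_nat (n choose k) * N k P (N (n - k) Q R))" if "k \<le> n" for k
  proof -
    have "N k P ((\<lambda>_. ?c (n - k)) * N (n - k) Q R)
        = (- 1) ^ k * N k ((\<lambda>_. ?c (n - k)) * N (n - k) Q R) P" by (rule N_skew)
    also have "N k ((\<lambda>_. ?c (n - k)) * N (n - k) Q R) P = (\<lambda>_. ?c (n - k)) * N k (N (n - k) Q R) P"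
      by (rule N_casimir_left[OF const_casimir]) (use PQR polyfun_N in auto)
    finally have "N k P ((\<lambda>_. ?c (n - k)) * N (n - k) Q R) = (\<lambda>_. ?c (n - k)) * N k P (N (n - k) Q R)"
      unfolding N_skew[of k P "N (n - k) Q R"] by (simp only: mult.left_commute)
    moreover have "?c k * (?c (n - k) * x) = ?c n * (of_nat (n choose k) * x)" for x
      using c[OF that] by (simp only: mult.assoc[symmetric])
    ultimately show ?thesis by (simp only: fun_eq_iff times_fun_apply of_nat_fun_apply simp_thms)
  qed
  have "(\<Sum>k\<le>n. C k (C (n - k) f g) h)
      = cut (\<Sum>k\<le>n. (\<lambda>_. ?c n) * (of_nat (n choose k) * N k (N (n - k) P Q) R))"
    unfolding PQR(2,4,6) star_coeff_cut cut_sum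
    by (rule arg_cong[where f = cut], rule sum.cong[OF refl], rule N_N) simp
  also have "\<dots> = cut (\<Sum>k\<le>n. (\<lambda>_. ?c n) * (of_nat (n choose k) * N k P (N (n - k) Q R)))"
    using sum_N_N_left[OF PQR(1,3,5), of n] sum_N_N_right[OF PQR(1,3,5), of n]
    by (simp only: sum_distrib_left[symmetric])
  also have "\<dots> = (\<Sum>k\<le>n. C k f (C (n - k) g h))"
    unfolding PQR(2,4,6) star_coeff_cut cut_sum
    by (rule arg_cong[where f = cut], rule sum.cong[OF refl], rule N_N'[symmetric]) simp
  finally show ?thesis .
qed


section \<open>The star product at a scalar\<close>

definition star_scalar :: "complex \<Rightarrow> (complex ^ 'n \<Rightarrow> complex) \<Rightarrow> (complex ^ 'n \<Rightarrow> complex) \<Rightarrow> complex ^ 'n \<Rightarrow> complex" where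
  "star_scalar c f g Z = suminf (\<lambda>k. c ^ k * C k f g Z)"

lemma star_scalar_eq:
  assumes "f \<in> H0 p" "g \<in> H0 q" "p \<le> K"
  shows "star_scalar c f g Z = (\<Sum>k\<le>K. c ^ k * C k f g Z)"
  unfolding star_scalar_def
proof (rule suminf_finite)
  fix k assume "k \<notin> {..K}"
  then have "C k f g = 0" using assms by (intro C_eq_0[OF assms(1,2)]) simp
  then show "c ^ k * C k f g Z = 0" by (simp add: zero_fun_def)
qed simp

lemma star_scalar_eq_fun:
  assumes "f \<in> H0 p" "g \<in> H0 q" "p \<le> K"
  shows "star_scalar c f g = (\<Sum>k\<le>K. (\<lambda>Z. c ^ k * C k f g Z))"
  by (rule ext) (simp add: star_scalar_eq[OF assms] sum_fun_apply)

lemma star_scalar_H0: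
  assumes "f \<in> H0 p" "g \<in> H0 q"
  shows "star_scalar c f g \<in> H0 (p + q)"
  unfolding star_scalar_eq_fun[OF assms order_refl] by (intro H0_sum_closed H0_scale C_H0 assms)

lemma star_scalar_lincomb_left:
  assumes "\<And>i. i \<in> A \<Longrightarrow> f i \<in> H0 p" "g \<in> H0 q"
  shows "star_scalar c (\<Sum>i\<in>A. (\<lambda>Z. a i * f i Z)) g = (\<Sum>i\<in>A. (\<lambda>Z. a i * star_scalar c (f i) g Z))"
proof
  fix Z
  have H: "(\<Sum>i\<in>A. (\<lambda>Z. a i * f i Z)) \<in> H0 p" by (intro H0_sum_closed H0_scale assms)
  have "C k (\<Sum>i\<in>A. (\<lambda>Z. a i * f i Z)) g = (\<Sum>i\<in>A. (\<lambda>Z. a i * C k (f i) g Z))" for k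
    using assms by (simp add: C_sum_left[where p = p and q = q] H0_scale C_scale_left[where p = p and q = q])
  then have "star_scalar c (\<Sum>i\<in>A. (\<lambda>Z. a i * f i Z)) g Z
      = (\<Sum>k\<le>p. \<Sum>i\<in>A. c ^ k * (a i * C k (f i) g Z))"
    by (simp add: star_scalar_eq[OF H assms(2) order_refl] sum_fun_apply sum_distrib_left)
  also have "\<dots> = (\<Sum>i\<in>A. \<Sum>k\<le>p. c ^ k * (a i * C k (f i) g Z))" by (rule sum.swap)
  also have "\<dots> = (\<Sum>i\<in>A. a i * star_scalar c (f i) g Z)"
    using assms by (simp add: star_scalar_eq[where p = p and q = q and K = p] sum_distrib_left mult.left_commute)
  finally show "star_scalar c (\<Sum>i\<in>A. (\<lambda>Z. a i * f i Z)) g Z = (\<Sum>i\<in>A. (\<lambda>Z. a i * star_scalar c (f i) g Z)) Z"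
    by (simp add: sum_fun_apply)
qed

lemma star_scalar_lincomb_right:
  assumes "f \<in> H0 p" "\<And>i. i \<in> A \<Longrightarrow> g i \<in> H0 q"
  shows "star_scalar c f (\<Sum>i\<in>A. (\<lambda>Z. a i * g i Z)) = (\<Sum>i\<in>A. (\<lambda>Z. a i * star_scalar c f (g i) Z))"
proof
  fix Z
  have H: "(\<Sum>i\<in>A. (\<lambda>Z. a i * g i Z)) \<in> H0 q" by (intro H0_sum_closed H0_scale assms)
  have "C k f (\<Sum>i\<in>A. (\<lambda>Z. a i * g i Z)) = (\<Sum>i\<in>A. (\<lambda>Z. a i * C k f (g i) Z))" for k
    using assms by (simp add: C_sum_right[where p = p and q = q] H0_scale C_scale_right[where p = p and q = q])
  then have "star_scalar c f (\<Sum>i\<in>A. (\<lambda>Z. a i * g i Z)) Z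
      = (\<Sum>k\<le>p. \<Sum>i\<in>A. c ^ k * (a i * C k f (g i) Z))"
    by (simp add: star_scalar_eq[OF assms(1) H order_refl] sum_fun_apply sum_distrib_left)
  also have "\<dots> = (\<Sum>i\<in>A. \<Sum>k\<le>p. c ^ k * (a i * C k f (g i) Z))" by (rule sum.swap)
  also have "\<dots> = (\<Sum>i\<in>A. a i * star_scalar c f (g i) Z)"
    using assms by (simp add: star_scalar_eq[where p = p and q = q and K = p] sum_distrib_left mult.left_commute)
  finally show "star_scalar c f (\<Sum>i\<in>A. (\<lambda>Z. a i * g i Z)) Z = (\<Sum>i\<in>A. (\<lambda>Z. a i * star_scalar c f (g i) Z)) Z"
    by (simp add: sum_fun_apply)
qed

lemma star_scalar_add_left:
  assumes "f \<in> H0 p" "f' \<in> H0 p" "g \<in> H0 q"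
  shows "star_scalar c (f + f') g = star_scalar c f g + star_scalar c f' g"
  using star_scalar_lincomb_left[of UNIV "\<lambda>b. if b then f else f'" p g q c "\<lambda>_. 1"] assms
  by (simp add: UNIV_bool add.commute)

lemma star_scalar_add_right:
  assumes "f \<in> H0 p" "g \<in> H0 q" "g' \<in> H0 q"
  shows "star_scalar c f (g + g') = star_scalar c f g + star_scalar c f g'"
  using star_scalar_lincomb_right[of f p UNIV "\<lambda>b. if b then g else g'" q c "\<lambda>_. 1"] assms
  by (simp add: UNIV_bool add.commute)

lemma star_scalar_scale_left:
  assumes "f \<in> H0 p" "g \<in> H0 q"
  shows "star_scalar c (\<lambda>Z. a * f Z) g = (\<lambda>Z. a * star_scalar c f g Z)"
  using star_scalar_lincomb_left[of "UNIV :: unit set" "\<lambda>_. f" p g q c "\<lambda>_. a"] assms by (simp add: UNIV_unit)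

lemma star_scalar_scale_right:
  assumes "f \<in> H0 p" "g \<in> H0 q"
  shows "star_scalar c f (\<lambda>Z. a * g Z) = (\<lambda>Z. a * star_scalar c f g Z)"
  using star_scalar_lincomb_right[of f p "UNIV :: unit set" "\<lambda>_. g" q c "\<lambda>_. a"] assms by (simp add: UNIV_unit)

lemma star_scalar_zero_left: "g \<in> H0 q \<Longrightarrow> star_scalar c 0 g = 0"
  using star_scalar_scale_left[OF H0_zero[of 0], of g q c 0] by (simp add: zero_fun_def)

lemma star_scalar_zero_right: "f \<in> H0 p \<Longrightarrow> star_scalar c f 0 = 0"
  using star_scalar_scale_right[OF _ H0_zero[of 0], of f p c 0] by (simp add: zero_fun_def)

lemma star_scalar_sum_left:
  assumes "\<And>i. i \<in> A \<Longrightarrow> f i \<in> H0 p" "g \<in> H0 q"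
  shows "star_scalar c (sum f A) g = (\<Sum>i\<in>A. star_scalar c (f i) g)"
  using star_scalar_lincomb_left[of A f p g q c "\<lambda>_. 1"] assms by simp

lemma star_scalar_sum_right:
  assumes "f \<in> H0 p" "\<And>i. i \<in> A \<Longrightarrow> g i \<in> H0 q"
  shows "star_scalar c f (sum g A) = (\<Sum>i\<in>A. star_scalar c f (g i))"
  using star_scalar_lincomb_right[of f p A g q c "\<lambda>_. 1"] assms by simp

text \<open>
  Associativity holds order by order in \<open>c\<close>; \<open>K\<close> bounds the orders that occur in either
  bracketing.
\<close>

lemma star_scalar_assoc:
  assumes f: "f \<in> H0 p" and g: "g \<in> H0 q" and h: "h \<in> H0 r"
  shows "star_scalar c (star_scalar c f g) h = star_scalar c f (star_scalar c g h)"
proof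
  fix Z
  define K where "K = p + q"
  have K: "p \<le> K" "q \<le> K" "p + q \<le> K" by (auto simp: K_def)
  have L0: "C k (C l f g) h = 0" if "K < k \<or> K < l" for k l
  proof (cases "K < l")
    case True
    then have "C l f g = 0" by (intro C_eq_0[OF f g]) (simp add: K_def)
    then show ?thesis using C_zero_left[OF h] by simp
  next
    case False
    then show ?thesis using that K by (intro C_eq_0[OF C_H0[OF f g] h]) simp
  qed
  have R0: "C k f (C l g h) = 0" if "K < k \<or> K < l" for k l
  proof (cases "K < l")
    case True
    then have "C l g h = 0" by (intro C_eq_0[OF g h]) (simp add: K_def)
    then show ?thesis using C_zero_right[OF f] by simp
  next
    case False
    then show ?thesis using that K by (intro C_eq_0[OF f C_H0[OF g h]]) simp
  qed
  have "star_scalar c (star_scalar c f g) h Z = (\<Sum>k\<le>K. \<Sum>l\<le>K. c ^ (k + l) * C k (C l f g) h Z)"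
  proof -
    have "C k (star_scalar c f g) h = (\<Sum>l\<le>K. (\<lambda>Z. c ^ l * C k (C l f g) h Z))" for k
      unfolding star_scalar_eq_fun[OF f g K(1)]
      by (subst C_sum_left[where p = "p + q" and q = r])
         (auto intro!: H0_scale C_H0 f g h sum.cong C_scale_left[OF C_H0[OF f g] h])
    then show ?thesis
      unfolding star_scalar_eq[OF star_scalar_H0[OF f g] h K(3)]
      by (simp add: sum_fun_apply sum_distrib_left power_add mult.assoc)
  qed
  also have "\<dots> = (\<Sum>n\<le>K+K. \<Sum>k\<le>n. c ^ (k + (n - k)) * C k (C (n - k) f g) h Z)"
    by (rule sum_square_triangle) (use L0 in \<open>auto simp: zero_fun_def\<close>)
  also have "\<dots> = (\<Sum>n\<le>K+K. c ^ n * (\<Sum>k\<le>n. C k (C (n - k) f g) h) Z)"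
    by (simp add: sum_distrib_left sum_fun_apply)
  also have "\<dots> = (\<Sum>n\<le>K+K. c ^ n * (\<Sum>k\<le>n. C k f (C (n - k) g h)) Z)"
    unfolding C_assoc[OF f g h] ..
  also have "\<dots> = (\<Sum>n\<le>K+K. \<Sum>k\<le>n. c ^ (k + (n - k)) * C k f (C (n - k) g h) Z)"
    by (simp add: sum_distrib_left sum_fun_apply)
  also have "\<dots> = (\<Sum>k\<le>K. \<Sum>l\<le>K. c ^ (k + l) * C k f (C l g h) Z)"
    by (rule sum_square_triangle[symmetric]) (use R0 in \<open>auto simp: zero_fun_def\<close>)
  also have "\<dots> = star_scalar c f (star_scalar c g h) Z"
  proof -
    have "C k f (star_scalar c g h) = (\<Sum>l\<le>K. (\<lambda>Z. c ^ l * C k f (C l g h) Z))" for k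
      unfolding star_scalar_eq_fun[OF g h K(2)]
      by (subst C_sum_right[where p = p and q = "q + r"])
         (auto intro!: H0_scale C_H0 f g h sum.cong C_scale_right[OF f C_H0[OF g h]])
    then show ?thesis
      unfolding star_scalar_eq[OF f star_scalar_H0[OF g h] K(1)]
      by (simp add: sum_fun_apply sum_distrib_left power_add mult.assoc)
  qed
  finally show "star_scalar c (star_scalar c f g) h Z = star_scalar c f (star_scalar c g h) Z" .
qed

lemma star_at_eq: "star_at c \<Lambda> F G m = (\<Sum>p\<le>m. star_scalar c (F p) (G (m - p)))"
  by (rule ext) (simp add: star_at_def star_scalar_def sum_fun_apply)

lemma H0_sum_D: "F \<in> H0_sum \<Longrightarrow> F p \<in> H0 p"
  by (simp add: H0_sum_def)

lemma H0_sum_bound: "F \<in> H0_sum \<Longrightarrow> \<exists>L. \<forall>p>L. F p = 0"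
  unfolding H0_sum_def finite_nat_set_iff_bounded_le by (auto simp: not_le) (metis not_le)

lemma H0_sum_I:
  assumes "\<And>p. F p \<in> H0 p" "\<And>p. L < p \<Longrightarrow> F p = 0"
  shows "F \<in> H0_sum"
proof -
  have "{p. F p \<noteq> 0} \<subseteq> {..L}" using assms(2) not_le by auto
  then show ?thesis using assms(1) finite_subset unfolding H0_sum_def by blast
qed

lemma star_at_H0_sum:
  assumes "F \<in> H0_sum" "G \<in> H0_sum"
  shows "star_at c \<Lambda> F G \<in> H0_sum"
proof -
  obtain M L where bd: "\<And>p. M < p \<Longrightarrow> F p = 0" "\<And>p. L < p \<Longrightarrow> G p = 0"
    using H0_sum_bound assms by meson
  show ?thesis
  proof (rule H0_sum_I[where L = "M + L"])
    fix m
    have "star_scalar c (F p) (G (m - p)) \<in> H0 m" if "p \<le> m" for p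
      using star_scalar_H0[OF H0_sum_D[OF assms(1)] H0_sum_D[OF assms(2)], of c p "m - p"] that by simp
    then show "star_at c \<Lambda> F G m \<in> H0 m" unfolding star_at_eq by (intro H0_sum_closed) auto
  next
    fix m assume m: "M + L < m"
    have "star_scalar c (F p) (G (m - p)) = 0" for p
    proof (cases "M < p")
      case True
      then show ?thesis using bd(1) star_scalar_zero_left[OF H0_sum_D[OF assms(2)]] by simp
    next
      case False
      then have "L < m - p" using m by simp
      then show ?thesis using bd(2) star_scalar_zero_right[OF H0_sum_D[OF assms(1)]] by simp
    qed
    then show "star_at c \<Lambda> F G m = 0" unfolding star_at_eq by simp
  qed
qed

lemma star_at_add_left:
  assumes "F \<in> H0_sum" "F' \<in> H0_sum" "G \<in> H0_sum"
  shows "star_at c \<Lambda> (F + F') G = star_at c \<Lambda> F G + star_at c \<Lambda> F' G"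
  by (rule ext)
     (simp add: star_at_eq plus_fun_apply[of F] plus_fun_apply[of "star_at c \<Lambda> F G"] sum.distrib
        star_scalar_add_left[OF H0_sum_D[OF assms(1)] H0_sum_D[OF assms(2)] H0_sum_D[OF assms(3)]])

lemma star_at_add_right:
  assumes "F \<in> H0_sum" "G \<in> H0_sum" "G' \<in> H0_sum"
  shows "star_at c \<Lambda> F (G + G') = star_at c \<Lambda> F G + star_at c \<Lambda> F G'"
  by (rule ext)
     (simp add: star_at_eq plus_fun_apply[of G] plus_fun_apply[of "star_at c \<Lambda> F G"] sum.distrib
        star_scalar_add_right[OF H0_sum_D[OF assms(1)] H0_sum_D[OF assms(2)] H0_sum_D[OF assms(3)]])

lemma star_at_scale_left:
  assumes "F \<in> H0_sum" "G \<in> H0_sum"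
  shows "star_at c \<Lambda> (scale_C a F) G = scale_C a (star_at c \<Lambda> F G)"
  by (intro ext)
     (simp add: star_at_eq scale_C_def sum_fun_apply sum_distrib_left
        star_scalar_scale_left[OF H0_sum_D[OF assms(1)] H0_sum_D[OF assms(2)]])

lemma star_at_scale_right:
  assumes "F \<in> H0_sum" "G \<in> H0_sum"
  shows "star_at c \<Lambda> F (scale_C a G) = scale_C a (star_at c \<Lambda> F G)"
  by (intro ext)
     (simp add: star_at_eq scale_C_def sum_fun_apply sum_distrib_left
        star_scalar_scale_right[OF H0_sum_D[OF assms(1)] H0_sum_D[OF assms(2)]])

lemma star_at_assoc:
  assumes "F \<in> H0_sum" "G \<in> H0_sum" "H \<in> H0_sum"
  shows "star_at c \<Lambda> (star_at c \<Lambda> F G) H = star_at c \<Lambda> F (star_at c \<Lambda> G H)"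
proof
  fix m
  have F: "F p \<in> H0 p" and G: "G p \<in> H0 p" and H: "H p \<in> H0 p" for p
    using assms by (auto intro: H0_sum_D)
  have "star_at c \<Lambda> (star_at c \<Lambda> F G) H m
      = (\<Sum>j\<le>m. \<Sum>i\<le>j. star_scalar c (star_scalar c (F i) (G (j - i))) (H (m - j)))"
    unfolding star_at_eq
  proof (intro sum.cong refl)
    fix j
    have "star_scalar c (F i) (G (j - i)) \<in> H0 j" if "i \<in> {..j}" for i
      using star_scalar_H0[OF F G, of c i "j - i"] that by simp
    then show "star_scalar c (\<Sum>i\<le>j. star_scalar c (F i) (G (j - i))) (H (m - j))
        = (\<Sum>i\<le>j. star_scalar c (star_scalar c (F i) (G (j - i))) (H (m - j)))"
      using H by (rule star_scalar_sum_left)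
  qed
  also have "\<dots> = (\<Sum>j\<le>m. \<Sum>i\<le>j. star_scalar c (F i) (star_scalar c (G (j - i)) (H (m - j))))"
    using star_scalar_assoc[OF F G H] by simp
  also have "\<dots> = (\<Sum>i\<le>m. \<Sum>j\<le>m - i. star_scalar c (F i) (star_scalar c (G j) (H (m - i - j))))"
    by (rule sum_assoc_reindex)
  also have "\<dots> = star_at c \<Lambda> F (star_at c \<Lambda> G H) m"
    unfolding star_at_eq
  proof (intro sum.cong refl)
    fix i
    have "star_scalar c (G j) (H (m - i - j)) \<in> H0 (m - i)" if "j \<in> {..m - i}" for j
    proof -
      have "j + (m - i - j) = m - i" using that by simp
      then show ?thesis using star_scalar_H0[OF G H, of c j "m - i - j"] by (simp only:)
    qed
    then show "(\<Sum>j\<le>m - i. star_scalar c (F i) (star_scalar c (G j) (H (m - i - j))))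
        = star_scalar c (F i) (\<Sum>j\<le>m - i. star_scalar c (G j) (H (m - i - j)))"
      by (rule star_scalar_sum_right[OF F, symmetric])
  qed
  finally show "star_at c \<Lambda> (star_at c \<Lambda> F G) H m = star_at c \<Lambda> F (star_at c \<Lambda> G H) m" .
qed

lemma assoc_bilinear_star_at: "assoc_bilinear_product H0_sum scale_C (star_at c \<Lambda>)"
  unfolding assoc_bilinear_product_def
  by (intro conjI ballI allI star_at_H0_sum star_at_add_left star_at_add_right star_at_scale_left
      star_at_scale_right star_at_assoc)

end


section \<open>Laurent polynomials in the parameter\<close>

lemma H0_sum_mu_D: "F \<in> H0_sum_mu \<Longrightarrow> F p i \<in> H0 p"
  by (simp add: H0_sum_mu_def)

lemma H0_sum_mu_bound:
  assumes "F \<in> H0_sum_mu"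
  shows "\<exists>M J. \<forall>p i. F p i \<noteq> 0 \<longrightarrow> p \<le> M \<and> i \<in> {- int J..int J}"
proof -
  have fin: "finite {(p, i). F p i \<noteq> 0}" using assms by (simp add: H0_sum_mu_def)
  obtain M where M: "\<forall>p\<in>fst ` {(p, i). F p i \<noteq> 0}. p \<le> M"
    using finite_imageI[OF fin, of fst] unfolding finite_nat_set_iff_bounded_le by blast
  obtain J where J: "\<forall>j\<in>(\<lambda>(p, i). nat \<bar>i\<bar>) ` {(p, i). F p i \<noteq> 0}. j \<le> J"
    using finite_imageI[OF fin, of "\<lambda>(p, i). nat \<bar>i\<bar>"] unfolding finite_nat_set_iff_bounded_le by blast
  have "p \<le> M \<and> i \<in> {- int J..int J}" if "F p i \<noteq> 0" for p i
  proof -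
    have "p \<le> M" using M that by force
    moreover have "nat \<bar>i\<bar> \<le> J" using J that by force
    ultimately show ?thesis by auto
  qed
  then show ?thesis by blast
qed

lemma H0_sum_mu_I:
  assumes "\<And>p i. F p i \<in> H0 p" "\<And>p i. F p i \<noteq> 0 \<Longrightarrow> p \<le> M \<and> i \<in> I" "finite I"
  shows "F \<in> H0_sum_mu"
proof -
  have "{(p, i). F p i \<noteq> 0} \<subseteq> {..M} \<times> I" using assms(2) by auto
  then have "finite {(p, i). F p i \<noteq> 0}" using assms(3) finite_subset by blast
  then show ?thesis using assms(1) by (simp add: H0_sum_mu_def)
qed

lemma specialize_eq:
  assumes "finite I" "\<And>i. F p i \<noteq> 0 \<Longrightarrow> i \<in> I"
  shows "specialize c F p = (\<Sum>i\<in>I. (\<lambda>Z. c powi i * F p i Z))"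
proof
  fix Z
  have "(\<Sum>i\<in>{i. F p i \<noteq> 0}. c powi i * F p i Z) = (\<Sum>i\<in>I. c powi i * F p i Z)"
    by (rule sum.mono_neutral_left) (use assms in \<open>auto simp: zero_fun_def\<close>)
  then show "specialize c F p Z = (\<Sum>i\<in>I. (\<lambda>Z. c powi i * F p i Z)) Z"
    by (simp add: specialize_def sum_fun_apply)
qed

lemma specialize_H0_sum:
  assumes "F \<in> H0_sum_mu"
  shows "specialize c F \<in> H0_sum"
proof -
  obtain M J where MJ: "\<And>p i. F p i \<noteq> 0 \<Longrightarrow> p \<le> M \<and> i \<in> {- int J..int J}"
    using H0_sum_mu_bound[OF assms] by blast
  have eq: "specialize c F p = (\<Sum>i\<in>{- int J..int J}. (\<lambda>Z. c powi i * F p i Z))" for p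
    by (rule specialize_eq) (use MJ in auto)
  have "specialize c F p = 0" if "M < p" for p
  proof -
    have "F p i = 0" for i using MJ that not_le by blast
    then show ?thesis by (simp add: specialize_def fun_eq_iff)
  qed
  moreover have "specialize c F p \<in> H0 p" for p
    unfolding eq by (intro H0_sum_closed H0_scale H0_sum_mu_D assms)
  ultimately have "{p. specialize c F p \<noteq> 0} \<subseteq> {..M}" by (auto simp: not_le intro: leI)
  then show ?thesis
    using \<open>\<And>p. specialize c F p \<in> H0 p\<close> finite_subset unfolding H0_sum_def by blast
qed

lemma H0_sum_mu_add:
  assumes "F \<in> H0_sum_mu" "G \<in> H0_sum_mu"
  shows "F + G \<in> H0_sum_mu"
proof -
  have "{(p, i). (F + G) p i \<noteq> 0} \<subseteq> {(p, i). F p i \<noteq> 0} \<union> {(p, i). G p i \<noteq> 0}"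
    by auto
  moreover have "finite ({(p, i). F p i \<noteq> 0} \<union> {(p, i). G p i \<noteq> 0})"
    using assms by (simp add: H0_sum_mu_def)
  ultimately have "finite {(p, i). (F + G) p i \<noteq> 0}" by (rule finite_subset)
  moreover have "(F + G) p i \<in> H0 p" for p i
    using H0_add[OF H0_sum_mu_D[OF assms(1)] H0_sum_mu_D[OF assms(2)], of p i i] by simp
  ultimately show ?thesis unfolding H0_sum_mu_def by blast
qed

lemma specialize_add:
  assumes "F \<in> H0_sum_mu" "G \<in> H0_sum_mu"
  shows "specialize c (F + G) = specialize c F + specialize c G"
proof
  fix p
  obtain M J where MJ: "\<And>p i. F p i \<noteq> 0 \<Longrightarrow> p \<le> M \<and> i \<in> {- int J..int J}"
    using H0_sum_mu_bound[OF assms(1)] by blast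
  obtain M' J' where MJ': "\<And>p i. G p i \<noteq> 0 \<Longrightarrow> p \<le> M' \<and> i \<in> {- int J'..int J'}"
    using H0_sum_mu_bound[OF assms(2)] by blast
  let ?I = "{- int J..int J} \<union> {- int J'..int J'}"
  have "specialize c (F + G) p = (\<Sum>i\<in>?I. (\<lambda>Z. c powi i * (F + G) p i Z))"
  proof (rule specialize_eq)
    fix i assume "(F + G) p i \<noteq> 0"
    then have "F p i \<noteq> 0 \<or> G p i \<noteq> 0" by auto
    then show "i \<in> ?I" using MJ MJ' by blast
  qed simp
  moreover have "specialize c F p = (\<Sum>i\<in>?I. (\<lambda>Z. c powi i * F p i Z))"
    by (rule specialize_eq) (use MJ in auto)
  moreover have "specialize c G p = (\<Sum>i\<in>?I. (\<lambda>Z. c powi i * G p i Z))"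
    by (rule specialize_eq) (use MJ' in auto)
  ultimately show "specialize c (F + G) p = (specialize c F + specialize c G) p"
    by (simp add: fun_eq_iff sum_fun_apply distrib_left sum.distrib)
qed

lemma scale_mu_support:
  assumes "scale_mu r F p i \<noteq> 0"
  shows "\<exists>s\<in>Poly_Mapping.keys r. F p (i - s) \<noteq> 0"
proof (rule ccontr)
  assume "\<not> ?thesis"
  then have "scale_mu r F p i = 0" unfolding scale_mu_def by (auto simp: fun_eq_iff)
  with assms show False by simp
qed

lemma scale_mu_H0_sum_mu:
  assumes "F \<in> H0_sum_mu"
  shows "scale_mu r F \<in> H0_sum_mu"
proof -
  let ?K = "Poly_Mapping.keys r"
  obtain M J where MJ: "\<And>p i. F p i \<noteq> 0 \<Longrightarrow> p \<le> M \<and> i \<in> {- int J..int J}"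
    using H0_sum_mu_bound[OF assms] by blast
  have eq: "scale_mu r F p i = (\<Sum>s\<in>?K. (\<lambda>Z. Poly_Mapping.lookup r s * F p (i - s) Z))" for p i
    by (rule ext) (simp add: scale_mu_def sum_fun_apply)
  show ?thesis
  proof (rule H0_sum_mu_I[where M = M and I = "\<Union>s\<in>?K. (\<lambda>i. i + s) ` {- int J..int J}"])
    show "scale_mu r F p i \<in> H0 p" for p i
      unfolding eq by (intro H0_sum_closed H0_scale H0_sum_mu_D assms)
    fix p i assume "scale_mu r F p i \<noteq> 0"
    then obtain s where s: "s \<in> ?K" "F p (i - s) \<noteq> 0" using scale_mu_support by blast
    then have "p \<le> M" "i - s \<in> {- int J..int J}" using MJ by auto
    then show "p \<le> M \<and> i \<in> (\<Union>s\<in>?K. (\<lambda>i. i + s) ` {- int J..int J})"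
      using s(1) by (auto intro!: bexI[of _ s] image_eqI[of _ _ "i - s"])
  qed auto
qed

definition evaluate_mu :: "complex \<Rightarrow> (int \<Rightarrow>\<^sub>0 complex) \<Rightarrow> complex" where
  "evaluate_mu c r = (\<Sum>s\<in>Poly_Mapping.keys r. Poly_Mapping.lookup r s * c powi s)"

lemma specialize_scale_mu:
  assumes "F \<in> H0_sum_mu" "c \<noteq> 0"
  shows "specialize c (scale_mu r F) = scale_C (evaluate_mu c r) (specialize c F)"
proof (intro ext)
  fix p Z
  let ?K = "Poly_Mapping.keys r" and ?l = "Poly_Mapping.lookup r"
  obtain M J where MJ: "\<And>p i. F p i \<noteq> 0 \<Longrightarrow> p \<le> M \<and> i \<in> {- int J..int J}"
    using H0_sum_mu_bound[OF assms(1)] by blast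
  let ?I = "\<Union>s\<in>?K. (\<lambda>i. i + s) ` {- int J..int J}"
  have shift: "(\<Sum>i\<in>?I. c powi i * F p (i - s) Z) = c powi s * specialize c F p Z" if s: "s \<in> ?K" for s
  proof -
    have "(\<Sum>i\<in>?I. c powi i * F p (i - s) Z)
        = (\<Sum>i\<in>(\<lambda>i. i + s) ` {- int J..int J}. c powi i * F p (i - s) Z)"
    proof (rule sum.mono_neutral_right)
      show "\<forall>i\<in>?I - (\<lambda>i. i + s) ` {- int J..int J}. c powi i * F p (i - s) Z = 0"
      proof
        fix i assume "i \<in> ?I - (\<lambda>i. i + s) ` {- int J..int J}"
        then have "i - s \<notin> {- int J..int J}" by (auto simp: image_iff)
        then have "F p (i - s) = 0" using MJ by blast
        then show "c powi i * F p (i - s) Z = 0" by simp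
      qed
    qed (use s in auto)
    also have "\<dots> = (\<Sum>i\<in>{- int J..int J}. c powi (i + s) * F p i Z)"
      by (subst sum.reindex) (auto simp: inj_on_def)
    also have "\<dots> = c powi s * (\<Sum>i\<in>{- int J..int J}. c powi i * F p i Z)"
      using assms(2) by (simp add: power_int_add sum_distrib_left mult_ac)
    also have "(\<Sum>i\<in>{- int J..int J}. c powi i * F p i Z) = specialize c F p Z"
      by (subst specialize_eq[of "{- int J..int J}"]) (use MJ in \<open>auto simp: sum_fun_apply\<close>)
    finally show ?thesis .
  qed
  have "specialize c (scale_mu r F) p Z = (\<Sum>i\<in>?I. c powi i * scale_mu r F p i Z)"
  proof -
    have "i \<in> ?I" if nz: "scale_mu r F p i \<noteq> 0" for i
    proof -
      obtain s where s: "s \<in> ?K" "F p (i - s) \<noteq> 0" using scale_mu_support[OF nz] by blast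
      then have "i - s \<in> {- int J..int J}" using MJ by blast
      then show ?thesis using s(1) by (auto intro!: bexI[of _ s] image_eqI[of _ _ "i - s"])
    qed
    then show ?thesis by (subst specialize_eq[of ?I]) (auto simp: sum_fun_apply)
  qed
  also have "\<dots> = (\<Sum>i\<in>?I. \<Sum>s\<in>?K. ?l s * (c powi i * F p (i - s) Z))"
    by (simp add: scale_mu_def sum_distrib_left mult.left_commute)
  also have "\<dots> = (\<Sum>s\<in>?K. ?l s * (\<Sum>i\<in>?I. c powi i * F p (i - s) Z))"
    by (subst sum.swap) (simp add: sum_distrib_left)
  also have "\<dots> = scale_C (evaluate_mu c r) (specialize c F) p Z"
    using shift by (simp add: scale_C_def evaluate_mu_def sum_distrib_right mult.assoc)
  finally show "specialize c (scale_mu r F) p Z = scale_C (evaluate_mu c r) (specialize c F) p Z" .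
qed

text \<open>
  A Laurent polynomial that vanishes at all nonzero scalars is zero. Identities between Laurent
  families can therefore be checked after specialization. The shift by \<open>L\<close> makes all exponents
  nonnegative; \<open>L\<close> exceeds all the exponents that occur, so that the constant coefficient is zero
  and \<open>c = 0\<close> is a root as well.
\<close>

lemma specialize_inject:
  assumes "F \<in> H0_sum_mu" "G \<in> H0_sum_mu" "\<And>c. c \<noteq> 0 \<Longrightarrow> specialize c F = specialize c G"
  shows "F = G"
proof (intro ext)
  fix p i Z
  obtain M J where MJ: "\<And>p i. F p i \<noteq> 0 \<Longrightarrow> p \<le> M \<and> i \<in> {- int J..int J}"
    using H0_sum_mu_bound[OF assms(1)] by blast
  obtain M' J' where MJ': "\<And>p i. G p i \<noteq> 0 \<Longrightarrow> p \<le> M' \<and> i \<in> {- int J'..int J'}"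
    using H0_sum_mu_bound[OF assms(2)] by blast
  define L where "L = Suc (max J J')"
  define d where "d n = F p (int n - int L) Z - G p (int n - int L) Z" for n
  have 0: "F p i = 0 \<and> G p i = 0" if "i \<notin> {- int L<..<int L}" for i
    using that MJ[of p i] MJ'[of p i] unfolding L_def by fastforce
  have "(\<Sum>n\<le>2*L. d n * c ^ n) = 0" for c
  proof (cases "c = 0")
    case True
    have "d 0 = 0" using 0[of "- int L"] by (simp add: d_def)
    then show ?thesis using True by (simp add: power_0_left if_distrib cong: if_cong)
  next
    case False
    have spec: "specialize c H p Z = (\<Sum>i\<in>{- int L..int L}. c powi i * H p i Z)"
      if "\<And>i. i \<notin> {- int L<..<int L} \<Longrightarrow> H p i = 0" for H
    proof -
      have "i \<in> {- int L..int L}" if "H p i \<noteq> 0" for i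
        using that \<open>\<And>i. i \<notin> {- int L<..<int L} \<Longrightarrow> H p i = 0\<close>[of i] by fastforce
      then show ?thesis by (subst specialize_eq[of "{- int L..int L}"]) (auto simp: sum_fun_apply)
    qed
    have "(\<Sum>n\<le>2*L. d n * c ^ n)
        = (\<Sum>i\<in>{- int L..int L}. c ^ L * (c powi i * F p i Z - c powi i * G p i Z))"
    proof (rule sum.reindex_bij_witness[of _ "\<lambda>i. nat (i + int L)" "\<lambda>n. int n - int L"])
      fix n assume "n \<in> {..2 * L}"
      have "c powi (int n) = c powi (int L) * c powi (int n - int L)"
        using False power_int_add[of c "int L" "int n - int L"] by simp
      then show "c ^ L * (c powi (int n - int L) * F p (int n - int L) Z
          - c powi (int n - int L) * G p (int n - int L) Z) = d n * c ^ n"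
        by (simp add: d_def algebra_simps)
    qed auto
    also have "\<dots> = c ^ L * (specialize c F p Z - specialize c G p Z)"
    proof -
      have "specialize c F p Z = (\<Sum>i\<in>{- int L..int L}. c powi i * F p i Z)"
        by (rule spec) (use 0 in blast)
      moreover have "specialize c G p Z = (\<Sum>i\<in>{- int L..int L}. c powi i * G p i Z)"
        by (rule spec) (use 0 in blast)
      ultimately show ?thesis by (simp add: sum_subtractf sum_distrib_left right_diff_distrib)
    qed
    also have "\<dots> = 0" using assms(3)[OF False] by simp
    finally show ?thesis .
  qed
  then have d: "\<forall>n\<le>2*L. d n = 0" using zero_polynom_imp_zero_coeffs[where c = d and n = "2 * L"] by blast
  show "F p i Z = G p i Z"
  proof (cases "i \<in> {- int L<..<int L}")
    case True
    then have "nat (i + int L) \<le> 2 * L" by auto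
    then have "d (nat (i + int L)) = 0" using d by blast
    then show ?thesis using True by (simp add: d_def)
  next
    case False
    then show ?thesis using 0 by metis
  qed
qed

context star_bivector
begin

lemma star_mu_eq:
  assumes "F \<in> H0_sum_mu" "G \<in> H0_sum_mu" "finite I" "finite I'"
    and "\<And>p i. F p i \<noteq> 0 \<Longrightarrow> i \<in> I" "\<And>p i. G p i \<noteq> 0 \<Longrightarrow> i \<in> I'"
  shows "star_mu \<Lambda> F G m j = (\<Sum>p\<le>m. \<Sum>s\<in>I. \<Sum>t\<in>I'.
     if s + t \<le> j then C (nat (j - s - t)) (F p s) (G (m - p) t) else 0)"
proof
  fix Z
  have "star_mu \<Lambda> F G m j Z = (\<Sum>p\<le>m. \<Sum>s\<in>I. \<Sum>t\<in>I'.
     if s + t \<le> j then C (nat (j - s - t)) (F p s) (G (m - p) t) Z else 0)"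
    unfolding star_mu_def
  proof (rule sum.cong[OF refl])
    fix p
    let ?t = "\<lambda>s t. if s + t \<le> j then C (nat (j - s - t)) (F p s) (G (m - p) t) Z else 0"
    have F0: "?t s t = 0" if "F p s = 0" for s t
      using that C_zero_left[OF H0_sum_mu_D[OF assms(2)]] by (simp add: zero_fun_def)
    have G0: "?t s t = 0" if "G (m - p) t = 0" for s t
      using that C_zero_right[OF H0_sum_mu_D[OF assms(1)]] by (simp add: zero_fun_def)
    have "(\<Sum>s\<in>{s. F p s \<noteq> 0}. \<Sum>t\<in>{t. G (m - p) t \<noteq> 0}. ?t s t)
        = (\<Sum>s\<in>{s. F p s \<noteq> 0}. \<Sum>t\<in>I'. ?t s t)"
      by (rule sum.cong[OF refl], rule sum.mono_neutral_left) (use assms G0 in auto)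
    also have "\<dots> = (\<Sum>s\<in>I. \<Sum>t\<in>I'. ?t s t)"
      by (rule sum.mono_neutral_left) (use assms F0 in \<open>auto intro!: sum.neutral\<close>)
    finally show "(\<Sum>s\<in>{s. F p s \<noteq> 0}. \<Sum>t\<in>{t. G (m - p) t \<noteq> 0}. ?t s t)
        = (\<Sum>s\<in>I. \<Sum>t\<in>I'. ?t s t)" .
  qed
  then show "star_mu \<Lambda> F G m j Z = (\<Sum>p\<le>m. \<Sum>s\<in>I. \<Sum>t\<in>I'.
     if s + t \<le> j then C (nat (j - s - t)) (F p s) (G (m - p) t) else 0) Z"
    by (simp add: sum_fun_apply if_distrib[of "\<lambda>h. h Z"] zero_fun_apply cong: if_cong)
qed

text \<open>
  The order \<open>k\<close> of a contributing term is at most the degree of the first factor, hence at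
  most \<open>m\<close>.
\<close>

lemma star_mu_support:
  assumes F: "F \<in> H0_sum_mu" and G: "G \<in> H0_sum_mu"
    and J: "\<And>p i. F p i \<noteq> 0 \<Longrightarrow> i \<in> {- int J..int J}"
    and J': "\<And>p i. G p i \<noteq> 0 \<Longrightarrow> i \<in> {- int J'..int J'}"
    and nz: "star_mu \<Lambda> F G m j \<noteq> 0"
  shows "\<exists>p s t. p \<le> m \<and> F p s \<noteq> 0 \<and> G (m - p) t \<noteq> 0 \<and> j \<in> {- int (J + J')..int (J + J' + m)}"
proof -
  let ?t = "\<lambda>p s t. if s + t \<le> j then C (nat (j - s - t)) (F p s) (G (m - p) t) else 0"
  have "\<exists>p\<in>{..m}. \<exists>s\<in>{- int J..int J}. \<exists>t\<in>{- int J'..int J'}. ?t p s t \<noteq> 0"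
  proof (rule ccontr)
    assume "\<not> ?thesis"
    then have "star_mu \<Lambda> F G m j = 0"
      by (subst star_mu_eq[OF F G _ _ J J']) (auto intro!: sum.neutral)
    with nz show False by simp
  qed
  then obtain p s t where *: "p \<le> m" "s \<in> {- int J..int J}" "t \<in> {- int J'..int J'}" "?t p s t \<noteq> 0"
    by blast
  have st: "s + t \<le> j" "C (nat (j - s - t)) (F p s) (G (m - p) t) \<noteq> 0"
    using *(4) by (auto split: if_splits)
  have "nat (j - s - t) \<le> p"
    using st(2) C_eq_0[OF H0_sum_mu_D[OF F] H0_sum_mu_D[OF G]] not_le by blast
  then have "j \<in> {- int (J + J')..int (J + J' + m)}" using *(1,2,3) st(1) by auto
  moreover have "F p s \<noteq> 0" using st(2) C_zero_left[OF H0_sum_mu_D[OF G]] by metis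
  moreover have "G (m - p) t \<noteq> 0" using st(2) C_zero_right[OF H0_sum_mu_D[OF F]] by metis
  ultimately show ?thesis using *(1) by blast
qed

lemma star_mu_H0_sum_mu:
  assumes F: "F \<in> H0_sum_mu" and G: "G \<in> H0_sum_mu"
  shows "star_mu \<Lambda> F G \<in> H0_sum_mu"
proof -
  obtain M J where MJ: "\<And>p i. F p i \<noteq> 0 \<Longrightarrow> p \<le> M" "\<And>p i. F p i \<noteq> 0 \<Longrightarrow> i \<in> {- int J..int J}"
    using H0_sum_mu_bound[OF F] by blast
  obtain M' J' where MJ': "\<And>p i. G p i \<noteq> 0 \<Longrightarrow> p \<le> M'" "\<And>p i. G p i \<noteq> 0 \<Longrightarrow> i \<in> {- int J'..int J'}"
    using H0_sum_mu_bound[OF G] by blast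
  \<comment> \<open>orders are bounded by degrees, so they extend the exponents by at most \<open>M + M'\<close>\<close>
  show ?thesis
  proof (rule H0_sum_mu_I[where M = "M + M'" and I = "{- int (J + J')..int (J + J' + (M + M'))}"])
    fix m j
    have term_H0: "(if s + t \<le> j then C (nat (j - s - t)) (F p s) (G (m - p) t) else 0) \<in> H0 m"
      if "p \<le> m" for p s t
      using C_H0[OF H0_sum_mu_D[OF F] H0_sum_mu_D[OF G], of _ p s "m - p" t] that by (auto intro: H0_zero)
    have "star_mu \<Lambda> F G m j = (\<Sum>p\<le>m. \<Sum>s\<in>{- int J..int J}. \<Sum>t\<in>{- int J'..int J'}.
        if s + t \<le> j then C (nat (j - s - t)) (F p s) (G (m - p) t) else 0)"
      by (rule star_mu_eq[OF F G _ _ MJ(2) MJ'(2)]) auto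
    also have "\<dots> \<in> H0 m" by (intro H0_sum_closed term_H0) auto
    finally show "star_mu \<Lambda> F G m j \<in> H0 m" .
    assume nz: "star_mu \<Lambda> F G m j \<noteq> 0"
    have "\<exists>p s t. p \<le> m \<and> F p s \<noteq> 0 \<and> G (m - p) t \<noteq> 0 \<and> j \<in> {- int (J + J')..int (J + J' + m)}"
      by (rule star_mu_support[OF F G _ _ nz]) (use MJ(2) MJ'(2) in blast)+
    then obtain p s t where *: "p \<le> m" "F p s \<noteq> 0" "G (m - p) t \<noteq> 0" "j \<in> {- int (J + J')..int (J + J' + m)}"
      by blast
    then have "p \<le> M" "m - p \<le> M'" using MJ(1) MJ'(1) by auto
    then have "m \<le> M + M'" by simp
    with *(4) show "m \<le> M + M' \<and> j \<in> {- int (J + J')..int (J + J' + (M + M'))}" by auto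
  qed auto
qed

text \<open>
  For fixed exponents \<open>s\<close> and \<open>t\<close>, the sum over the exponents \<open>j\<close> of \<open>\<mu>\<close> is the sum over the orders
  \<open>k = j - s - t\<close> that defines the star product at \<open>\<mu> = c\<close>.
\<close>

lemma specialize_star_mu:
  assumes F: "F \<in> H0_sum_mu" and G: "G \<in> H0_sum_mu" and c: "c \<noteq> 0"
  shows "specialize c (star_mu \<Lambda> F G) = star_at c \<Lambda> (specialize c F) (specialize c G)"
proof (intro ext)
  fix m Z
  obtain J where J: "\<And>p i. F p i \<noteq> 0 \<Longrightarrow> i \<in> {- int J..int J}"
    using H0_sum_mu_bound[OF F] by blast
  obtain J' where J': "\<And>p i. G p i \<noteq> 0 \<Longrightarrow> i \<in> {- int J'..int J'}"
    using H0_sum_mu_bound[OF G] by blast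
  let ?S = "{- int J..int J}" and ?T = "{- int J'..int J'}" and ?U = "{- int (J + J')..int (J + J' + m)}"
  have single: "(\<Sum>j\<in>?U. c powi j * (if s + t \<le> j then C (nat (j - s - t)) (F p s) (G (m - p) t) Z else 0))
      = c powi s * (c powi t * star_scalar c (F p s) (G (m - p) t) Z)"
    if p: "p \<le> m" and st: "s \<in> ?S" "t \<in> ?T" for p s t
  proof -
    let ?h = "\<lambda>j. c powi j * C (nat (j - s - t)) (F p s) (G (m - p) t) Z"
    have "(\<Sum>j\<in>?U. c powi j * (if s + t \<le> j then C (nat (j - s - t)) (F p s) (G (m - p) t) Z else 0))
        = (\<Sum>j\<in>{s+t..s+t+int p}. ?h j)"
    proof (rule sum.mono_neutral_cong_right)
      show "\<forall>j\<in>?U - {s+t..s+t+int p}.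
          c powi j * (if s + t \<le> j then C (nat (j - s - t)) (F p s) (G (m - p) t) Z else 0) = 0"
      proof
        fix j assume j: "j \<in> ?U - {s+t..s+t+int p}"
        show "c powi j * (if s + t \<le> j then C (nat (j - s - t)) (F p s) (G (m - p) t) Z else 0) = 0"
        proof (cases "s + t \<le> j")
          case True
          then have "p < nat (j - s - t)" using j by auto
          then have "C (nat (j - s - t)) (F p s) (G (m - p) t) = 0"
            by (rule C_eq_0[OF H0_sum_mu_D[OF F] H0_sum_mu_D[OF G]])
          then show ?thesis by (simp add: zero_fun_apply)
        qed simp
      qed
    qed (use st p in auto)
    also have "\<dots> = (\<Sum>k\<le>p. c powi s * (c powi t * (c ^ k * C k (F p s) (G (m - p) t) Z)))"
    proof (rule sum.reindex_bij_witness[of _ "\<lambda>k. s + t + int k" "\<lambda>j. nat (j - s - t)"])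
      fix j assume "j \<in> {s+t..s+t+int p}"
      then have "c powi j = c powi (s + t + int (nat (j - s - t)))" by simp
      also have "\<dots> = c powi s * c powi t * c ^ nat (j - s - t)"
        using c power_int_add[of c "s + t" "int (nat (j - s - t))"] power_int_add[of c s t]
        by (simp only: power_int_of_nat simp_thms)
      finally show "c powi s * (c powi t * (c ^ nat (j - s - t) * C (nat (j - s - t)) (F p s) (G (m - p) t) Z)) = ?h j"
        by simp
    qed auto
    also have "\<dots> = c powi s * (c powi t * star_scalar c (F p s) (G (m - p) t) Z)"
      by (simp add: star_scalar_eq[OF H0_sum_mu_D[OF F] H0_sum_mu_D[OF G] order_refl] sum_distrib_left)
    finally show ?thesis .
  qed
  have "specialize c (star_mu \<Lambda> F G) m Z = (\<Sum>j\<in>?U. c powi j * star_mu \<Lambda> F G m j Z)"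
  proof -
    have "\<exists>p s t. p \<le> m \<and> F p s \<noteq> 0 \<and> G (m - p) t \<noteq> 0 \<and> j \<in> ?U"
      if "star_mu \<Lambda> F G m j \<noteq> 0" for j
      by (rule star_mu_support[OF F G _ _ that]) (use J J' in blast)+
    then show ?thesis by (subst specialize_eq[of ?U]) (auto simp: sum_fun_apply)
  qed
  also have "\<dots> = (\<Sum>j\<in>?U. \<Sum>p\<le>m. \<Sum>s\<in>?S. \<Sum>t\<in>?T.
      c powi j * (if s + t \<le> j then C (nat (j - s - t)) (F p s) (G (m - p) t) Z else 0))"
  proof (rule sum.cong[OF refl])
    fix j
    have "star_mu \<Lambda> F G m j = (\<Sum>p\<le>m. \<Sum>s\<in>?S. \<Sum>t\<in>?T.
        if s + t \<le> j then C (nat (j - s - t)) (F p s) (G (m - p) t) else 0)"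
      by (rule star_mu_eq[OF F G _ _ J J']) auto
    then show "c powi j * star_mu \<Lambda> F G m j Z = (\<Sum>p\<le>m. \<Sum>s\<in>?S. \<Sum>t\<in>?T.
        c powi j * (if s + t \<le> j then C (nat (j - s - t)) (F p s) (G (m - p) t) Z else 0))"
      by (simp add: sum_fun_apply sum_distrib_left if_distrib[of "\<lambda>h. h Z"] zero_fun_apply cong: if_cong)
  qed
  also have "\<dots> = (\<Sum>p\<le>m. \<Sum>s\<in>?S. \<Sum>t\<in>?T. \<Sum>j\<in>?U.
      c powi j * (if s + t \<le> j then C (nat (j - s - t)) (F p s) (G (m - p) t) Z else 0))"
    by (simp only: sum.swap[where A = ?U])
  also have "\<dots> = (\<Sum>p\<le>m. \<Sum>s\<in>?S. \<Sum>t\<in>?T. c powi s * (c powi t * star_scalar c (F p s) (G (m - p) t) Z))"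
    by (intro sum.cong refl single) auto
  also have "\<dots> = (\<Sum>p\<le>m. star_scalar c (specialize c F p) (specialize c G (m - p)) Z)"
  proof (rule sum.cong[OF refl])
    fix p
    have specF: "specialize c F p = (\<Sum>s\<in>?S. (\<lambda>Z. c powi s * F p s Z))"
      by (rule specialize_eq) (use J in auto)
    have specG: "specialize c G (m - p) = (\<Sum>t\<in>?T. (\<lambda>Z. c powi t * G (m - p) t Z))"
      by (rule specialize_eq) (use J' in auto)
    have G': "specialize c G (m - p) \<in> H0 (m - p)"
      using specialize_H0_sum[OF G] by (simp add: H0_sum_def)
    have "star_scalar c (specialize c F p) (specialize c G (m - p))
        = (\<Sum>s\<in>?S. (\<lambda>Z. c powi s * star_scalar c (F p s) (specialize c G (m - p)) Z))"
      unfolding specF by (rule star_scalar_lincomb_left[OF H0_sum_mu_D[OF F] G'])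
    moreover have "star_scalar c (F p s) (specialize c G (m - p))
        = (\<Sum>t\<in>?T. (\<lambda>Z. c powi t * star_scalar c (F p s) (G (m - p) t) Z))" for s
      unfolding specG by (rule star_scalar_lincomb_right[OF H0_sum_mu_D[OF F] H0_sum_mu_D[OF G]])
    ultimately show "(\<Sum>s\<in>?S. \<Sum>t\<in>?T. c powi s * (c powi t * star_scalar c (F p s) (G (m - p) t) Z))
        = star_scalar c (specialize c F p) (specialize c G (m - p)) Z"
      by (simp add: sum_fun_apply sum_distrib_left)
  qed
  also have "\<dots> = star_at c \<Lambda> (specialize c F) (specialize c G) m Z"
    by (simp add: star_at_eq sum_fun_apply)
  finally show "specialize c (star_mu \<Lambda> F G) m Z = star_at c \<Lambda> (specialize c F) (specialize c G) m Z" .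
qed

text \<open>
  Every identity is inherited from the star products at nonzero scalars by injectivity of
  specialization.
\<close>

lemma assoc_bilinear_star_mu: "assoc_bilinear_product H0_sum_mu scale_mu (star_mu \<Lambda>)"
  unfolding assoc_bilinear_product_def
proof (intro conjI ballI allI)
  fix F G H :: "nat \<Rightarrow> int \<Rightarrow> complex ^ 'n \<Rightarrow> complex"
  assume F: "F \<in> H0_sum_mu" and G: "G \<in> H0_sum_mu" and H: "H \<in> H0_sum_mu"
  note mem = star_mu_H0_sum_mu H0_sum_mu_add F G H
  note hom = specialize_star_mu specialize_add
  note spec = specialize_H0_sum[OF F] specialize_H0_sum[OF G] specialize_H0_sum[OF H]
  show "star_mu \<Lambda> (F + G) H = star_mu \<Lambda> F H + star_mu \<Lambda> G H"
    by (rule specialize_inject) (simp_all only: mem hom spec star_at_add_left not_False_eq_True)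
  show "star_mu \<Lambda> F (G + H) = star_mu \<Lambda> F G + star_mu \<Lambda> F H"
    by (rule specialize_inject) (simp_all only: mem hom spec star_at_add_right not_False_eq_True)
  show "star_mu \<Lambda> (star_mu \<Lambda> F G) H = star_mu \<Lambda> F (star_mu \<Lambda> G H)"
    by (rule specialize_inject) (simp_all only: mem hom spec star_at_assoc not_False_eq_True)
next
  fix r and F G :: "nat \<Rightarrow> int \<Rightarrow> complex ^ 'n \<Rightarrow> complex"
  assume F: "F \<in> H0_sum_mu" and G: "G \<in> H0_sum_mu"
  note mem = star_mu_H0_sum_mu scale_mu_H0_sum_mu F G
  note hom = specialize_star_mu specialize_scale_mu
  note spec = specialize_H0_sum[OF F] specialize_H0_sum[OF G]
  show "star_mu \<Lambda> F G \<in> H0_sum_mu" using star_mu_H0_sum_mu F G .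
  show "star_mu \<Lambda> (scale_mu r F) G = scale_mu r (star_mu \<Lambda> F G)"
    by (rule specialize_inject) (simp_all only: mem hom spec star_at_scale_left not_False_eq_True)
  show "star_mu \<Lambda> F (scale_mu r G) = scale_mu r (star_mu \<Lambda> F G)"
    by (rule specialize_inject) (simp_all only: mem hom spec star_at_scale_right not_False_eq_True)
qed

end


section \<open>Associativity on the sum of the cohomology spaces\<close>

theorem theorem1p2:
  fixes \<Lambda> :: "'n::finite \<Rightarrow> 'n \<Rightarrow> complex ^ 'n \<Rightarrow> complex"
  assumes order_zero: "\<And>\<alpha> \<beta>. \<Lambda> \<alpha> \<beta> \<in> sections 2 (UNIV - {0})"
    and skew: "\<And>\<alpha> \<beta> Z. \<Lambda> \<alpha> \<beta> Z = - \<Lambda> \<beta> \<alpha> Z"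
    and jacobi: "\<And>U p q r f g h Z. open_cone U \<Longrightarrow> f \<in> sections p U \<Longrightarrow> g \<in> sections q U \<Longrightarrow>
        h \<in> sections r U \<Longrightarrow> Z \<in> U \<Longrightarrow>
        bracket \<Lambda> f (bracket \<Lambda> g h) Z + bracket \<Lambda> g (bracket \<Lambda> h f) Z
          + bracket \<Lambda> h (bracket \<Lambda> f g) Z = 0"
    and arrows: "\<And>k U p q f g Z. 1 \<le> k \<Longrightarrow> open_cone U \<Longrightarrow> f \<in> sections p U \<Longrightarrow>
        g \<in> sections q U \<Longrightarrow> Z \<in> U \<Longrightarrow>
        arrow_product \<Lambda> k f g Z = normal_product \<Lambda> k f g Z"
  shows "(\<forall>p q. \<forall>f\<in>H0 p. \<forall>g\<in>H0 q.
            (\<forall>k. star_coeff \<Lambda> k f g \<in> H0 (p + q)) \<and> finite {k. star_coeff \<Lambda> k f g \<noteq> 0})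
    \<and> assoc_bilinear_product H0_sum_mu scale_mu (star_mu \<Lambda>)
    \<and> (\<forall>c. assoc_bilinear_product H0_sum scale_C (star_at c \<Lambda>))
    \<and> (\<forall>c. c \<noteq> 0 \<longrightarrow> (\<forall>F\<in>H0_sum_mu. \<forall>G\<in>H0_sum_mu.
            specialize c F \<in> H0_sum \<and>
            specialize c (star_mu \<Lambda> F G) = star_at c \<Lambda> (specialize c F) (specialize c G)))"
proof -
  have poly: "\<Lambda> a b \<in> polyfun" and hom: "homogeneous 2 (\<Lambda> a b)" for a b
    using section_2_polyfun[OF order_zero] by auto
  have skew': "\<Lambda> a b = - \<Lambda> b a" for a b
    by (rule ext, subst skew) simp
  have "(\<Sum>d\<in>UNIV. \<Lambda> d c * pd d (\<Lambda> a b)) = 0" for a b c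
  proof (rule polyfun_eqI)
    fix Z :: "complex ^ 'n" assume "Z \<noteq> 0"
    then have Z: "Z \<in> UNIV - {0}" by simp
    have "(\<Sum>d\<in>UNIV. \<Lambda> d c Z * pd d (\<Lambda> a b) Z) = 0"
    proof (rule casimir_if_arrow_2_and_jacobi[OF poly skew'])
      fix a b c
      show "bracket \<Lambda> (\<lambda>Z. Z $ a) (bracket \<Lambda> (\<lambda>Z. Z $ b) (\<lambda>Z. Z $ c)) Z
         + bracket \<Lambda> (\<lambda>Z. Z $ b) (bracket \<Lambda> (\<lambda>Z. Z $ c) (\<lambda>Z. Z $ a)) Z
         + bracket \<Lambda> (\<lambda>Z. Z $ c) (bracket \<Lambda> (\<lambda>Z. Z $ a) (\<lambda>Z. Z $ b)) Z = 0"
        by (rule jacobi[OF open_cone_UNIV coord_section coord_section coord_section Z])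
      show "arrow_product \<Lambda> 2 (\<lambda>Z. Z $ a) (\<lambda>Z. Z $ b) Z
         = normal_product \<Lambda> 2 (\<lambda>Z. Z $ a) (\<lambda>Z. Z $ b) Z"
        by (rule arrows[OF one_le_numeral open_cone_UNIV coord_section coord_section Z])
      show "arrow_product \<Lambda> 2 (\<lambda>Z. Z $ a) (\<lambda>Z. Z $ b * Z $ c) Z
         = normal_product \<Lambda> 2 (\<lambda>Z. Z $ a) (\<lambda>Z. Z $ b * Z $ c) Z"
        by (rule arrows[OF one_le_numeral open_cone_UNIV coord_section coord_mult_section Z])
    qed
    then show "(\<Sum>d\<in>UNIV. \<Lambda> d c * pd d (\<Lambda> a b)) Z = 0 Z" by (simp add: sum_fun_apply)
  qed (intro polyfun_intros polyfun_pd poly)+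
  then interpret star_bivector \<Lambda>
    using poly skew' hom by unfold_locales
  \<comment> \<open>\<open>k\<close> derivatives of \<open>f\<close> vanish as soon as \<open>k > p\<close>\<close>
  have "finite {k. star_coeff \<Lambda> k f g \<noteq> 0}" if "f \<in> H0 p" "g \<in> H0 q" for p q f g
  proof -
    have "{k. star_coeff \<Lambda> k f g \<noteq> 0} \<subseteq> {..p}" using C_eq_0[OF that] not_le by auto
    then show ?thesis by (rule finite_subset) simp
  qed
  then show ?thesis
    by (intro conjI allI ballI impI C_H0 assoc_bilinear_star_mu assoc_bilinear_star_at
        specialize_H0_sum specialize_star_mu) auto
qed

end
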